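(* Let $z$ be a real quadratic irrational with (eventually periodic) expansions $z=\lfloor a_0,a_1,\ldots,a_q,\overline{b_1,\ldots,b_l}\rfloor=\lceil c_0,c_1,\ldots,c_r,\overline{d_1,\ldots,d_m}\rceil$, where the period lengths $l$ and $m$ are smallest possible and, for these, $q$ and $r$ are smallest possible (with $q=-1$, resp. $r=-1$, in the purely periodic case). Let $L=l$ if $l$ is even and $L=2l$ if $l$ is odd, extend the period by $b_{l+j}=b_j$, and put $$B=(-1)^q\sum_{j=1}^{L}(-1)^{j-1}b_j,\qquad D=\frac1m\sum_{j=1}^m d_j.$$ Then $B>0$, $B=0$, $B<0$ hold iff $D<3$, $D=3$, $D>3$, respectively. Moreover, as $j,k\to\infty$: both $S(p_k,q_k)$ and $S(s_j,t_j)$ tend to $+\infty$ if $B>0$ (equivalently $D<3$); both remain bounded if $B=0$ (equivalently $D=3$); and both tend to $-\infty$ if $B<0$ (equivalently $D>3$).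
   Context: The regular continued fraction expansion $z=\lfloor a_0,a_1,\ldots\rfloor$ of an irrational $z$ is given by $z_0=z$, $a_0=\lfloor z_0\rfloor$, $z_{j+1}=1/(z_j-a_j)$, $a_{j+1}=\lfloor z_{j+1}\rfloor$, with convergents $p_k/q_k$: $p_{-1}=1,q_{-1}=0,p_0=a_0,q_0=1$, $p_{k+1}=a_{k+1}p_k+p_{k-1}$, $q_{k+1}=a_{k+1}q_k+q_{k-1}$. The negative regular expansion $z=\lceil c_0,c_1,\ldots\rceil$ (meaning $z=c_0-1/(c_1-1/(c_2-\cdots))$) is given by $z_0=z$, $c_0=\lceil z_0\rceil$, $z_{j+1}=1/(c_j-z_j)$, $c_{j+1}=\lceil z_{j+1}\rceil$, with convergents $s_j/t_j$: $s_{-1}=1,t_{-1}=0,s_0=c_0,t_0=1$, $s_{j+1}=c_{j+1}s_j-s_{j-1}$, $t_{j+1}=c_{j+1}t_j-t_{j-1}$. For an integer $a$ and natural number $b$, $S(a,b)=12\sum_{k=1}^b((k/b))((ak/b))$, where $((x))=x-\lfloor x\rfloor-1/2$ for $x\notin\mathbb Z$ and $((x))=0$ for $x\in\mathbb Z$ (12 times the classical Dedekind sum). *)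

theory Defs
  imports Complex_Main
begin

definition quadratic_irrational :: "real \<Rightarrow> bool" where
  "quadratic_irrational z \<longleftrightarrow>
     z \<notin> \<rat> \<and> (\<exists>a b c :: int. a \<noteq> 0 \<and> of_int a * z\<^sup>2 + of_int b * z + of_int c = 0)"

fun rcf_rem :: "real \<Rightarrow> nat \<Rightarrow> real" where
  "rcf_rem z 0 = z"
| "rcf_rem z (Suc j) = 1 / (rcf_rem z j - of_int \<lfloor>rcf_rem z j\<rfloor>)"

definition rcf_digit :: "real \<Rightarrow> nat \<Rightarrow> int" where
  "rcf_digit z j = \<lfloor>rcf_rem z j\<rfloor>"

text \<open>In the recursions for the convergents the values at index \<open>-1\<close>
  (numerator 1, denominator 0) have been inserted into the equation for index 1.\<close>

fun rcf_num :: "real \<Rightarrow> nat \<Rightarrow> int" where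
  "rcf_num z 0 = rcf_digit z 0"
| "rcf_num z (Suc 0) = rcf_digit z 1 * rcf_digit z 0 + 1"
| "rcf_num z (Suc (Suc k)) = rcf_digit z (Suc (Suc k)) * rcf_num z (Suc k) + rcf_num z k"

fun rcf_den :: "real \<Rightarrow> nat \<Rightarrow> int" where
  "rcf_den z 0 = 1"
| "rcf_den z (Suc 0) = rcf_digit z 1"
| "rcf_den z (Suc (Suc k)) = rcf_digit z (Suc (Suc k)) * rcf_den z (Suc k) + rcf_den z k"

fun ncf_rem :: "real \<Rightarrow> nat \<Rightarrow> real" where
  "ncf_rem z 0 = z"
| "ncf_rem z (Suc j) = 1 / (of_int \<lceil>ncf_rem z j\<rceil> - ncf_rem z j)"

definition ncf_digit :: "real \<Rightarrow> nat \<Rightarrow> int" where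
  "ncf_digit z j = \<lceil>ncf_rem z j\<rceil>"

fun ncf_num :: "real \<Rightarrow> nat \<Rightarrow> int" where
  "ncf_num z 0 = ncf_digit z 0"
| "ncf_num z (Suc 0) = ncf_digit z 1 * ncf_digit z 0 - 1"
| "ncf_num z (Suc (Suc j)) = ncf_digit z (Suc (Suc j)) * ncf_num z (Suc j) - ncf_num z j"

fun ncf_den :: "real \<Rightarrow> nat \<Rightarrow> int" where
  "ncf_den z 0 = 1"
| "ncf_den z (Suc 0) = ncf_digit z 1"
| "ncf_den z (Suc (Suc j)) = ncf_digit z (Suc (Suc j)) * ncf_den z (Suc j) - ncf_den z j"

definition periodic_from :: "(nat \<Rightarrow> 'a) \<Rightarrow> nat \<Rightarrow> nat \<Rightarrow> bool" where
  "periodic_from x n l \<longleftrightarrow> 0 < l \<and> (\<forall>j\<ge>n. x (j + l) = x j)"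

text \<open>The two \<open>LEAST\<close> values below are unspecified if the sequence is not eventually periodic.\<close>

definition period_length :: "(nat \<Rightarrow> 'a) \<Rightarrow> nat" where
  "period_length x = (LEAST l. \<exists>n. periodic_from x n l)"

definition preperiod_length :: "(nat \<Rightarrow> 'a) \<Rightarrow> nat" where
  "preperiod_length x = (LEAST n. periodic_from x n (period_length x))"

text \<open>If the preperiod is \<open>a\<^sub>0, \<dots>, a\<^sub>q\<close> (with \<open>q = -1\<close> if it is empty), then
  \<open>preperiod_length = q + 1\<close>, so that the sign \<open>(-1)\<^sup>q\<close> equals
  \<open>(-1)^(preperiod_length + 1)\<close>. The entries of the period, with its periodic
  continuation, are \<open>b\<^sub>j = a\<^bsub>q + j\<^esub>\<close> for \<open>j \<ge> 1\<close>.\<close>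

definition period_entry :: "(nat \<Rightarrow> 'a) \<Rightarrow> nat \<Rightarrow> 'a" where
  "period_entry x j = x (preperiod_length x + j - 1)"

definition rcf_even_period :: "real \<Rightarrow> nat" where
  "rcf_even_period z =
     (let l = period_length (rcf_digit z) in if even l then l else 2 * l)"

definition rcf_alternating_sum :: "real \<Rightarrow> int" where
  "rcf_alternating_sum z =
     (-1) ^ (preperiod_length (rcf_digit z) + 1) *
     (\<Sum>j = 1..rcf_even_period z. (-1) ^ (j - 1) * period_entry (rcf_digit z) j)"

definition ncf_period_mean :: "real \<Rightarrow> real" where
  "ncf_period_mean z =
     (let m = period_length (ncf_digit z)
      in (\<Sum>j = 1..m. of_int (period_entry (ncf_digit z) j)) / of_nat m)"

definition sawtooth :: "real \<Rightarrow> real" where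
  "sawtooth x = (if x \<in> \<int> then 0 else x - of_int \<lfloor>x\<rfloor> - 1 / 2)"

definition dedekind_S :: "int \<Rightarrow> nat \<Rightarrow> real" where
  "dedekind_S a b =
     12 * (\<Sum>k = 1..b. sawtooth (of_nat k / of_nat b) *
                      sawtooth (of_int a * of_nat k / of_nat b))"

text \<open>For irrational \<open>z\<close> all denominators of convergents are positive, so the
  conversion to \<open>nat\<close> loses nothing.\<close>

definition rcf_S :: "real \<Rightarrow> nat \<Rightarrow> real" where
  "rcf_S z k = dedekind_S (rcf_num z k) (nat (rcf_den z k))"

definition ncf_S :: "real \<Rightarrow> nat \<Rightarrow> real" where
  "ncf_S z j = dedekind_S (ncf_num z j) (nat (ncf_den z j))"

end

theory Submission
  imports Defs
begin

text \<open>Dedekind reciprocity turns one step of either expansion into a telescoping relation, so that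
  up to bounded terms \<open>S(p\<^sub>k,q\<^sub>k)\<close> is \<open>- \<Sum>\<^sub>j\<^sub>\<le>\<^sub>k (-1)\<^sup>j a\<^sub>j\<close> and \<open>S(s\<^sub>k,t\<^sub>k)\<close> is \<open>- \<Sum>\<^sub>j\<^sub>\<le>\<^sub>k (c\<^sub>j - 3)\<close>.
  By periodicity these sums are, up to bounded terms, linear with slopes \<open>B/L\<close> and \<open>3 - D\<close>.
  For \<open>i > 0\<close>, a pair \<open>a\<^sub>2\<^sub>i, a\<^sub>2\<^sub>i\<^sub>+\<^sub>1\<close> of regular digits corresponds to the block \<open>a\<^sub>2\<^sub>i + 2, 2, \<dots>, 2\<close> of
  \<open>a\<^sub>2\<^sub>i\<^sub>+\<^sub>1\<close> negative regular digits, whose excess over 3 is \<open>a\<^sub>2\<^sub>i - a\<^sub>2\<^sub>i\<^sub>+\<^sub>1\<close>. Hence the two sums agree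
  along these blocks up to a constant, and the slopes have the same sign.\<close>

section \<open>Dedekind sums and reciprocity\<close>

lemma sawtooth_add_of_int [simp]: "sawtooth (x + of_int m) = sawtooth x"
proof -
  have "x + of_int m \<in> \<int> \<longleftrightarrow> x \<in> \<int>"
    by (metis Ints_add Ints_diff Ints_of_int add_diff_cancel_right')
  then show ?thesis by (simp add: sawtooth_def)
qed

lemma sawtooth_of_int [simp]: "sawtooth (of_int m) = 0"
  by (simp add: sawtooth_def)

lemma sawtooth_minus: "sawtooth (- x) = - sawtooth x"
proof (cases "x \<in> \<int>")
  case True then show ?thesis by (simp add: sawtooth_def)
next
  case False
  have "\<lceil>x\<rceil> = \<lfloor>x\<rfloor> + 1"
    using False by (metis Ints_of_int ceiling_altdef)
  then have "\<lfloor>- x\<rfloor> = - \<lfloor>x\<rfloor> - 1"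
    by (simp add: floor_minus)
  with False show ?thesis by (simp add: sawtooth_def)
qed

lemma sawtooth_mod:
  assumes "n > 0"
  shows "sawtooth (of_int (m mod n) / of_int n) = sawtooth (of_int m / of_int n)"
proof -
  have "m = m mod n + m div n * n" by simp
  then have "real_of_int m = of_int (m mod n) + of_int (m div n) * of_int n"
    by (metis of_int_add of_int_mult)
  then have "of_int m / of_int n = of_int (m mod n) / of_int n + real_of_int (m div n)"
    using assms by (simp add: field_simps)
  then show ?thesis by simp
qed

lemma sawtooth_nonmultiple:
  assumes "n > 0" "\<not> n dvd m"
  shows "sawtooth (of_int m / of_int n) = of_int (m mod n) / of_int n - 1 / 2"
proof -
  have r: "0 < m mod n" "m mod n < n"
    using assms pos_mod_bound[of n m] pos_mod_sign[of n m]
    by (auto simp: dvd_eq_mod_eq_0 order.order_iff_strict simp del: pos_mod_sign)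
  define x where "x = real_of_int (m mod n) / of_int n"
  have x: "0 < x" "x < 1" using r by (auto simp: x_def)
  then have f: "\<lfloor>x\<rfloor> = 0" by (simp add: floor_eq_iff)
  then have "x \<notin> \<int>" using x by (metis Ints_cases floor_of_int less_irrefl of_int_0)
  then have "sawtooth x = x - 1 / 2" using f by (simp add: sawtooth_def)
  then show ?thesis using sawtooth_mod[OF assms(1)] by (simp add: x_def)
qed

text \<open>The terms \<open>k = n\<close> and \<open>k = 0\<close> both vanish, so the sum may run
  over the residues \<open>0..<n\<close>, which multiplication by a unit permutes. For
  \<open>n \<le> 0\<close> both sums are empty.\<close>

lemma dedekind_S_residues:
  "dedekind_S a (nat n) = 12 * (\<Sum>k\<in>{0..<n}.
     sawtooth (of_int k / of_int n) * sawtooth (of_int (a * k) / of_int n))"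
proof (cases "n > 0")
  case True
  let ?f = "\<lambda>k. sawtooth (of_int k / of_int n) * sawtooth (of_int (a * k) / of_int n)"
  have "(\<Sum>k = 1..nat n. sawtooth (of_nat k / of_nat (nat n)) *
          sawtooth (of_int a * of_nat k / of_nat (nat n))) = (\<Sum>k\<in>{1..n}. ?f k)"
    by (rule sum.reindex_bij_witness[of _ nat int]) (use True in auto)
  also have "{1..n} = insert n {1..<n}" using True by auto
  also have "sum ?f \<dots> = sum ?f {1..<n}"
    using True sawtooth_of_int[of 1] by simp
  also have "\<dots> = sum ?f (insert 0 {1..<n})" using sawtooth_of_int[of 0] by simp
  also have "insert 0 {1..<n} = {0..<n}" using True by auto
  finally show ?thesis by (simp add: dedekind_S_def)
qed (simp add: dedekind_S_def)

lemma dedekind_S_add_mult: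
  assumes "n > 0"
  shows "dedekind_S (a + m * n) (nat n) = dedekind_S a (nat n)"
proof -
  have "sawtooth (of_int ((a + m * n) * k) / of_int n) = sawtooth (of_int (a * k) / of_int n)"
    for k
  proof -
    have "(a + m * n) * k = a * k + (m * k) * n" by (simp add: algebra_simps)
    then have "(a + m * n) * k mod n = a * k mod n" by (metis mod_mult_self1)
    then show ?thesis using sawtooth_mod[OF assms] by metis
  qed
  then show ?thesis by (simp add: dedekind_S_residues)
qed

lemma dedekind_S_minus: "dedekind_S (- a) (nat n) = - dedekind_S a (nat n)"
  using sawtooth_minus by (simp add: dedekind_S_residues sum_negf)

lemma bij_betw_mult_mod:
  fixes a n :: int
  assumes "n > 0" "coprime a n"
  shows "bij_betw (\<lambda>k. a * k mod n) {0..<n} {0..<n}"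
proof -
  have "inj_on (\<lambda>k. a * k mod n) {0..<n}"
  proof (rule inj_onI)
    fix j k assume jk: "j \<in> {0..<n}" "k \<in> {0..<n}" "a * j mod n = a * k mod n"
    then have "n dvd a * (j - k)" by (simp add: mod_eq_dvd_iff algebra_simps)
    then have "n dvd j - k" using assms
      by (simp add: coprime_commute coprime_dvd_mult_right_iff)
    then have "j mod n = k mod n" by (simp add: mod_eq_dvd_iff)
    with jk show "j = k" by simp
  qed
  moreover have "(\<lambda>k. a * k mod n) ` {0..<n} \<subseteq> {0..<n}" using assms by auto
  ultimately show ?thesis by (simp add: bij_betw_def endo_inj_surj)
qed

text \<open>The substitution of \<open>a * k mod n\<close> for \<open>k\<close> permutes the
  residues and turns \<open>a' * k\<close> into \<open>k\<close> modulo \<open>n\<close>, so it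
  merely exchanges the two sawtooth factors.\<close>

lemma dedekind_S_inverse:
  assumes "n > 0" "n dvd a * a' - 1"
  shows "dedekind_S a' (nat n) = dedekind_S a (nat n)"
proof -
  have cop: "coprime a n"
  proof (rule coprimeI)
    fix c assume "c dvd a" "c dvd n"
    then have "c dvd a * a' - (a * a' - 1)"
      by (rule dvd_diff[OF dvd_mult2 dvd_trans[OF _ assms(2)]])
    moreover have "a * a' - (a * a' - 1) = 1" by simp
    ultimately show "is_unit c" by metis
  qed
  let ?\<sigma> = "\<lambda>m. sawtooth (of_int m / of_int n)"
  have "(\<Sum>k\<in>{0..<n}. ?\<sigma> k * ?\<sigma> (a' * k)) = (\<Sum>k\<in>{0..<n}. ?\<sigma> (a * k mod n) * ?\<sigma> (a' * (a * k mod n)))"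
    by (rule sum.reindex_bij_betw[OF bij_betw_mult_mod[OF assms(1) cop], symmetric])
  also have "\<dots> = (\<Sum>k\<in>{0..<n}. ?\<sigma> k * ?\<sigma> (a * k))"
  proof (rule sum.cong)
    fix k
    have "n dvd (a * a' - 1) * k" using assms(2) by simp
    then have "a' * (a * k) mod n = k mod n" by (simp add: mod_eq_dvd_iff algebra_simps)
    then have "a' * (a * k mod n) mod n = k mod n" by (simp add: mod_mult_right_eq)
    then have "?\<sigma> (a' * (a * k mod n)) = ?\<sigma> k" using sawtooth_mod[OF assms(1)] by metis
    then show "?\<sigma> (a * k mod n) * ?\<sigma> (a' * (a * k mod n)) = ?\<sigma> k * ?\<sigma> (a * k)"
      using sawtooth_mod[OF assms(1)] by simp
  qed simp
  finally show ?thesis unfolding dedekind_S_residues by simp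
qed

section \<open>Power sums, floor sums and the reciprocity law\<close>

lemma sum_atLeastLessThan_id_int: "n \<ge> 0 \<Longrightarrow> 2 * (\<Sum>k\<in>{0..<n}. k) = n * (n - 1)" for n :: int
proof (induction n rule: int_ge_induct)
  case (step i)
  then have "{0..<i + 1} = insert i {0..<i}" by auto
  with step show ?case by (simp add: algebra_simps)
qed simp

lemma sum_atLeastLessThan_square_int:
  "n \<ge> 0 \<Longrightarrow> 6 * (\<Sum>k\<in>{0..<n}. k\<^sup>2) = n * (n - 1) * (2 * n - 1)" for n :: int
proof (induction n rule: int_ge_induct)
  case (step i)
  then have "{0..<i + 1} = insert i {0..<i}" by auto
  with step show ?case by (simp add: algebra_simps power2_eq_square)
qed simp

text \<open>In \<open>a * k = n * (a * k div n) + a * k mod n\<close> the remainders run through a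
  permutation of \<open>0..<n\<close>; their sum is known, and the sum of the quotients
  follows.\<close>

lemma sum_div_coprime:
  fixes a n :: int
  assumes "n > 0" "coprime a n"
  shows "2 * (\<Sum>k\<in>{0..<n}. a * k div n) = (a - 1) * (n - 1)"
proof -
  have "(\<Sum>k\<in>{0..<n}. a * k) = (\<Sum>k\<in>{0..<n}. n * (a * k div n) + a * k mod n)" by simp
  also have "\<dots> = n * (\<Sum>k\<in>{0..<n}. a * k div n) + (\<Sum>k\<in>{0..<n}. k)"
    unfolding sum.distrib sum_distrib_left[symmetric]
    using sum.reindex_bij_betw[OF bij_betw_mult_mod[OF assms], of "\<lambda>k. k"] by simp
  finally have "a * (\<Sum>k\<in>{0..<n}. k) = n * (\<Sum>k\<in>{0..<n}. a * k div n) + (\<Sum>k\<in>{0..<n}. k)"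
    by (simp add: sum_distrib_left)
  then have "n * (2 * (\<Sum>k\<in>{0..<n}. a * k div n)) = (a - 1) * (2 * (\<Sum>k\<in>{0..<n}. k))"
    by (simp add: algebra_simps)
  also have "\<dots> = n * ((a - 1) * (n - 1))" using sum_atLeastLessThan_id_int[of n] assms by simp
  finally show ?thesis using assms by simp
qed

text \<open>Clears denominators, so that reciprocity becomes an identity between integers: once
  \<open>a * k mod n\<close> is written as \<open>a * k - n * (a * k div n)\<close>, only the sum of
  \<open>k * (a * k div n)\<close> lacks a closed form.\<close>

lemma dedekind_S_div_sum:
  assumes "n > 0" "coprime a n"
  shows "n * dedekind_S a (nat n) = of_int (2 * a * (n - 1) * (2 * n - 1) - 3 * n * (n - 1)
           - 12 * (\<Sum>k\<in>{0..<n}. k * (a * k div n)))"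
proof -
  let ?r = "\<lambda>k. a * k mod n"
  let ?F = "\<Sum>k\<in>{0..<n}. k * (a * k div n)"
  have split: "{0..<n} = insert 0 {1..<n}" using assms by auto
  have "dedekind_S a (nat n) = 12 * (\<Sum>k\<in>{1..<n}.
     sawtooth (of_int k / of_int n) * sawtooth (of_int (a * k) / of_int n))"
    unfolding dedekind_S_residues split using sawtooth_of_int[of 0] by simp
  also have "(\<Sum>k\<in>{1..<n}. sawtooth (of_int k / of_int n) * sawtooth (of_int (a * k) / of_int n))
     = (\<Sum>k\<in>{1..<n}. (of_int k / of_int n - 1/2) * (of_int (?r k) / of_int n - 1/2))"
  proof (rule sum.cong)
    fix k assume k: "k \<in> {1..<n}"
    then have 1: "\<not> n dvd k" using zdvd_imp_le[of n k] by auto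
    then have "\<not> n dvd a * k" using assms(2) by (simp add: coprime_commute coprime_dvd_mult_right_iff)
    with 1 k assms show "sawtooth (of_int k / of_int n) * sawtooth (of_int (a * k) / of_int n)
       = (of_int k / of_int n - 1/2) * (of_int (?r k) / of_int n - 1/2)"
      using sawtooth_nonmultiple[of n k] sawtooth_nonmultiple[of n "a * k"] by simp
  qed simp
  finally have "n\<^sup>2 * dedekind_S a (nat n) = 3 * (4 * n\<^sup>2 * (\<Sum>k\<in>{1..<n}.
      (of_int k / of_int n - 1/2) * (of_int (?r k) / of_int n - 1/2)))" by simp
  also have "4 * n\<^sup>2 * (\<Sum>k\<in>{1..<n}. (of_int k / of_int n - 1/2) * (of_int (?r k) / of_int n - 1/2))
      = (\<Sum>k\<in>{1..<n}. of_int ((2 * k - n) * (2 * ?r k - n)))"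
    unfolding sum_distrib_left
    by (rule sum.cong) (use assms in \<open>auto simp: field_simps power2_eq_square\<close>)
  \<comment> \<open>The index 0 is added back to have a full residue system; its term is
    \<open>n\<^sup>2\<close> and not the vanishing sawtooth product, hence the correction.\<close>
  also have "\<dots> = of_int ((\<Sum>k\<in>{0..<n}. (2 * k - n) * (2 * ?r k - n)) - n\<^sup>2)"
    unfolding split by (simp add: power2_eq_square)
  also have "(\<Sum>k\<in>{0..<n}. (2 * k - n) * (2 * ?r k - n))
      = (\<Sum>k\<in>{0..<n}. 4 * a * k\<^sup>2 - 4 * n * (k * (a * k div n)) - 2 * n * k - 2 * n * ?r k + n\<^sup>2)"
    by (rule sum.cong)
      (auto simp: minus_mult_div_eq_mod[symmetric] algebra_simps power2_eq_square)
  also have "\<dots> = 4 * a * (\<Sum>k\<in>{0..<n}. k\<^sup>2) - 4 * n * ?F - 2 * n * (\<Sum>k\<in>{0..<n}. k)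
       - 2 * n * (\<Sum>k\<in>{0..<n}. k) + n * n\<^sup>2"
    using sum.reindex_bij_betw[OF bij_betw_mult_mod[OF assms], of "\<lambda>k. k"] assms
    by (simp add: sum.distrib sum_subtractf sum_distrib_left[symmetric])
  finally have eq: "n\<^sup>2 * dedekind_S a (nat n) = of_int (3 * (4 * a * (\<Sum>k\<in>{0..<n}. k\<^sup>2) - 4 * n * ?F
      - 2 * n * (\<Sum>k\<in>{0..<n}. k) - 2 * n * (\<Sum>k\<in>{0..<n}. k) + n * n\<^sup>2 - n\<^sup>2))"
    by simp
  have "3 * (4 * a * (\<Sum>k\<in>{0..<n}. k\<^sup>2) - 4 * n * ?F
      - 2 * n * (\<Sum>k\<in>{0..<n}. k) - 2 * n * (\<Sum>k\<in>{0..<n}. k) + n * n\<^sup>2 - n\<^sup>2)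
    = 2 * a * (6 * (\<Sum>k\<in>{0..<n}. k\<^sup>2)) - 12 * n * ?F - 6 * n * (2 * (\<Sum>k\<in>{0..<n}. k)) + 3 * n * n\<^sup>2 - 3 * n\<^sup>2"
    by (simp add: algebra_simps)
  also have "\<dots> = n * (2 * a * (n - 1) * (2 * n - 1) - 3 * n * (n - 1) - 12 * ?F)"
    unfolding sum_atLeastLessThan_square_int[OF order.strict_implies_order[OF assms(1)]]
      sum_atLeastLessThan_id_int[OF order.strict_implies_order[OF assms(1)]]
    by (simp add: algebra_simps power2_eq_square)
  finally have *: "n * (n * dedekind_S a (nat n))
      = real_of_int n * of_int (2 * a * (n - 1) * (2 * n - 1) - 3 * n * (n - 1) - 12 * ?F)"
    using eq by (simp add: power2_eq_square)
  have "real_of_int n \<noteq> 0" using assms by simp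
  then show ?thesis using * by (rule mult_left_cancel[THEN iffD1])
qed

text \<open>Both sides count the pairs \<open>j n \<le> a k\<close> with weight \<open>2 j\<close>, once by \<open>k\<close> and once by \<open>j\<close>.\<close>

lemma sum_div_flip:
  fixes a n :: int
  assumes "n > 0" "a > 0" "coprime a n"
  shows "(\<Sum>k\<in>{0..<n}. (a * k div n) * (a * k div n + 1))
       = a * (a - 1) * (n - 1) - 2 * (\<Sum>j\<in>{0..<a}. j * (n * j div a))"
proof -
  have le_div: "j \<le> m div d \<longleftrightarrow> j * d \<le> m" if "d > 0" for j m d :: int
  proof
    assume "j \<le> m div d"
    then have "j * d \<le> m div d * d" using that by simp
    also have "\<dots> \<le> m" using that pos_mod_sign[of d m] by (simp add: minus_mod_eq_div_mult[symmetric])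
    finally show "j * d \<le> m" .
  next
    assume "j * d \<le> m"
    then show "j \<le> m div d" using that zdiv_mono1[of "j * d" m d] by simp
  qed
  have "(a * k div n) * (a * k div n + 1) = 2 * (\<Sum>j\<in>{0..<a}. if j * n \<le> a * k then j else 0)"
    if k: "k \<in> {0..<n}" for k
  proof -
    let ?f = "a * k div n"
    have "\<not> a \<le> ?f" unfolding le_div[OF assms(1)] using k assms by simp
    then have "?f < a" by simp
    have "?f \<ge> 0" using k assms by (simp add: pos_imp_zdiv_nonneg_iff)
    with \<open>?f \<ge> 0\<close> have "{j \<in> {0..<a}. j * n \<le> a * k} = {0..<?f + 1}"
      using \<open>?f < a\<close> by (auto simp: le_div[OF assms(1), symmetric])
    then show ?thesis using sum_atLeastLessThan_id_int[of "?f + 1"] \<open>?f \<ge> 0\<close>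
      by (simp add: sum.inter_filter[symmetric])
  qed
  then have "(\<Sum>k\<in>{0..<n}. (a * k div n) * (a * k div n + 1))
      = 2 * (\<Sum>k\<in>{0..<n}. \<Sum>j\<in>{0..<a}. if j * n \<le> a * k then j else 0)"
    by (simp add: sum_distrib_left)
  also have "\<dots> = 2 * (\<Sum>j\<in>{0..<a}. \<Sum>k\<in>{0..<n}. if j * n \<le> a * k then j else 0)"
    by (subst sum.swap) simp
  also have "(\<Sum>j\<in>{0..<a}. \<Sum>k\<in>{0..<n}. if j * n \<le> a * k then j else 0)
      = (\<Sum>j\<in>{0..<a}. (n - 1) * j - j * (n * j div a))"
  proof (rule sum.cong)
    fix j assume j: "j \<in> {0..<a}"
    define g where "g = n * j div a"
    have "(\<Sum>k\<in>{0..<n}. if j * n \<le> a * k then j else 0) = (n - 1) * j - j * g"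
    proof (cases "j = 0")
      case False
      have "\<not> a dvd j" using False j zdvd_imp_le[of a j] by auto
      then have "\<not> a dvd n * j" using assms(3) by (simp add: coprime_dvd_mult_right_iff)
      \<comment> \<open>For \<open>0 < j < a\<close> no integer \<open>k\<close> satisfies
        \<open>a * k = n * j\<close>, so the inequality is strict and becomes
        \<open>g < k\<close>.\<close>
      then have iff: "j * n \<le> a * k \<longleftrightarrow> g < k" for k
      proof -
        have "n * j \<noteq> a * k" using \<open>\<not> a dvd n * j\<close> by auto
        then have "j * n \<le> a * k \<longleftrightarrow> \<not> k * a \<le> n * j" by (auto simp: mult.commute)
        then show ?thesis unfolding g_def le_div[OF assms(2), symmetric] by auto
      qed
      have "\<not> n \<le> g" unfolding g_def le_div[OF assms(2)] using j assms by simp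
      then have "g < n" by simp
      have "g \<ge> 0" using j assms by (simp add: g_def pos_imp_zdiv_nonneg_iff)
      then have "{k \<in> {0..<n}. j * n \<le> a * k} = {g + 1..<n}" unfolding iff by auto
      with \<open>g < n\<close> show ?thesis
        by (simp add: sum.inter_filter[symmetric] algebra_simps)
    qed (simp cong: if_cong)
    then show "(\<Sum>k\<in>{0..<n}. if j * n \<le> a * k then j else 0) = (n - 1) * j - j * (n * j div a)"
      by (simp add: g_def)
  qed simp
  also have "\<dots> = (n - 1) * (\<Sum>j\<in>{0..<a}. j) - (\<Sum>j\<in>{0..<a}. j * (n * j div a))"
    by (simp only: sum_subtractf sum_distrib_left)
  finally have "(\<Sum>k\<in>{0..<n}. (a * k div n) * (a * k div n + 1))
      = (n - 1) * (2 * (\<Sum>j\<in>{0..<a}. j)) - 2 * (\<Sum>j\<in>{0..<a}. j * (n * j div a))"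
    by (simp only: right_diff_distrib mult.left_commute)
  then show ?thesis
    unfolding sum_atLeastLessThan_id_int[OF order.strict_implies_order[OF assms(2)]]
    by (simp only: mult.commute)
qed

text \<open>Multiplication by \<open>a\<close> permutes the residues modulo \<open>n\<close>, so the residues \<open>a k mod n\<close> have the same sum
  of squares as the \<open>k\<close>; expanding the squares gives the identity.\<close>

lemma sum_mult_div_reciprocity:
  fixes a n :: int
  assumes "n > 0" "a > 0" "coprime a n"
  shows "12 * (a * (\<Sum>k\<in>{0..<n}. k * (a * k div n)) + n * (\<Sum>j\<in>{0..<a}. j * (n * j div a)))
    = (a\<^sup>2 - 1) * (n - 1) * (2 * n - 1) + 6 * n * (n - 1) * a * (a - 1) - 3 * n * (a - 1) * (n - 1)"
proof -
  let ?f = "\<lambda>k. a * k div n"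
  let ?Q = "\<Sum>k\<in>{0..<n}. k\<^sup>2" and ?F = "\<Sum>k\<in>{0..<n}. k * ?f k" and ?G = "\<Sum>j\<in>{0..<a}. j * (n * j div a)"
  have "?Q = (\<Sum>k\<in>{0..<n}. (a * k mod n)\<^sup>2)"
    using sum.reindex_bij_betw[OF bij_betw_mult_mod[OF assms(1,3)], of "\<lambda>k. k\<^sup>2"] by simp
  also have "\<dots> = (\<Sum>k\<in>{0..<n}. a\<^sup>2 * k\<^sup>2 - 2 * a * n * (k * ?f k) + n\<^sup>2 * (?f k * (?f k + 1)) - n\<^sup>2 * ?f k)"
    by (rule sum.cong) (auto simp: minus_mult_div_eq_mod[symmetric] algebra_simps power2_eq_square)
  also have "\<dots> = a\<^sup>2 * ?Q - 2 * a * n * ?F + n\<^sup>2 * (\<Sum>k\<in>{0..<n}. ?f k * (?f k + 1)) - n\<^sup>2 * (\<Sum>k\<in>{0..<n}. ?f k)"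
    by (simp add: sum.distrib sum_subtractf sum_distrib_left)
  finally have "12 * n * (a * ?F) = (a\<^sup>2 - 1) * (6 * ?Q) + 6 * n\<^sup>2 * (a * (a - 1) * (n - 1) - 2 * ?G)
       - 3 * n\<^sup>2 * (2 * (\<Sum>k\<in>{0..<n}. ?f k))"
    unfolding sum_div_flip[OF assms] by (simp add: algebra_simps)
  also have "\<dots> = n * ((a\<^sup>2 - 1) * (n - 1) * (2 * n - 1) + 6 * n * (n - 1) * a * (a - 1)
      - 3 * n * (a - 1) * (n - 1) - 12 * n * ?G)"
    unfolding sum_div_coprime[OF assms(1,3)] sum_atLeastLessThan_square_int[OF order.strict_implies_order[OF assms(1)]]
    by (simp add: algebra_simps power2_eq_square)
  finally have "n * (12 * a * ?F) = n * ((a\<^sup>2 - 1) * (n - 1) * (2 * n - 1) + 6 * n * (n - 1) * a * (a - 1)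
      - 3 * n * (a - 1) * (n - 1) - 12 * n * ?G)" by (simp only: mult.assoc mult.left_commute)
  then show ?thesis using assms by (simp only: mult_cancel_left) (simp add: algebra_simps)
qed

text \<open>After multiplication by \<open>a * n\<close> the two floor sums occur exactly in the
  combination evaluated by \<open>sum_mult_div_reciprocity\<close>. The factor 12 in
  \<open>dedekind_S\<close> turns the classical constant 1/4 into 3.\<close>

lemma dedekind_S_reciprocity:
  assumes "n > 0" "a > 0" "coprime a n"
  shows "dedekind_S a (nat n) + dedekind_S n (nat a)
    = of_int a / of_int n + of_int n / of_int a + 1 / (of_int a * of_int n) - 3"
proof -
  let ?F = "\<Sum>k\<in>{0..<n}. k * (a * k div n)" and ?G = "\<Sum>j\<in>{0..<a}. j * (n * j div a)"
  have cop: "coprime n a" using assms(3) by (simp add: coprime_commute)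
  have "a * n * (dedekind_S a (nat n) + dedekind_S n (nat a))
      = a * (n * dedekind_S a (nat n)) + n * (a * dedekind_S n (nat a))"
    by (simp add: algebra_simps)
  also have "\<dots> = of_int (a * (2 * a * (n - 1) * (2 * n - 1) - 3 * n * (n - 1))
       + n * (2 * n * (a - 1) * (2 * a - 1) - 3 * a * (a - 1)) - 12 * (a * ?F + n * ?G))"
    unfolding dedekind_S_div_sum[OF assms(1,3)] dedekind_S_div_sum[OF assms(2) cop]
    by (simp add: algebra_simps)
  also have "\<dots> = of_int (a\<^sup>2 + n\<^sup>2 + 1 - 3 * a * n)"
    unfolding sum_mult_div_reciprocity[OF assms] of_int_eq_iff
    by (simp add: algebra_simps power2_eq_square)
  also have "\<dots> = a * n * (of_int a / of_int n + of_int n / of_int a + 1 / (of_int a * of_int n) - 3)"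
    using assms by (simp add: field_simps power2_eq_square)
  finally have *: "a * n * (dedekind_S a (nat n) + dedekind_S n (nat a))
      = a * n * (of_int a / of_int n + of_int n / of_int a + 1 / (of_int a * of_int n) - 3)" .
  have "real_of_int (a * n) \<noteq> 0" using assms by simp
  then show ?thesis using * by (rule mult_left_cancel[THEN iffD1])
qed

section \<open>Dedekind sums of convergents\<close>

text \<open>The sign \<open>e = 1\<close> gives the regular and \<open>e = -1\<close> the negative regular recursion. The index of \<open>P\<close> and \<open>Q\<close>
  is shifted by one: \<open>P (Suc k) / Q (Suc k)\<close> is the \<open>k\<close>-th convergent, with last partial quotient \<open>a k\<close>.\<close>

locale signed_continued_fraction =
  fixes e :: int and a P Q :: "nat \<Rightarrow> int"
  assumes sign: "e = 1 \<or> e = -1"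
    and P_0: "P 0 = 1" and P_1: "P (Suc 0) = a 0"
    and P_rec: "P (Suc (Suc k)) = a (Suc k) * P (Suc k) + e * P k"
    and Q_0: "Q 0 = 0" and Q_1: "Q (Suc 0) = 1"
    and Q_rec: "Q (Suc (Suc k)) = a (Suc k) * Q (Suc k) + e * Q k"
    and Q_pos: "Q (Suc k) > 0"
begin

text \<open>One step of the recursion multiplies the determinant by \<open>- e\<close>: it
  alternates in the regular case and stays \<open>-1\<close> in the negative regular one.\<close>

lemma determinant: "P (Suc k) * Q k - P k * Q (Suc k) = - ((- e) ^ k)"
proof (induction k)
  case 0
  show ?case by (simp add: P_0 Q_0 Q_1)
next
  case (Suc k)
  have "P (Suc (Suc k)) * Q (Suc k) - P (Suc k) * Q (Suc (Suc k))
      = - e * (P (Suc k) * Q k - P k * Q (Suc k))"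
    by (simp add: P_rec Q_rec algebra_simps)
  also have "\<dots> = - ((- e) ^ Suc k)" unfolding Suc.IH by simp
  finally show ?case .
qed

lemma sign_power_square: "(- e) ^ k * (- e) ^ k = 1"
  using sign by (auto simp: power_mult_distrib[symmetric])

lemma coprime_consecutive: "coprime (Q k) (Q (Suc k))"
proof (rule coprimeI)
  fix c assume "c dvd Q k" "c dvd Q (Suc k)"
  then have "c dvd - ((- e) ^ k)" unfolding determinant[symmetric] by simp
  then have "c dvd (- e) ^ k * (- e) ^ k" by simp
  then show "is_unit c" unfolding sign_power_square .
qed

lemma dedekind_S_sign: "dedekind_S (e * b) (nat n) = e * dedekind_S b (nat n)"
  using sign by (auto simp: dedekind_S_minus)

lemma dedekind_S_sign_power: "dedekind_S ((- e) ^ k * b) (nat n) = (- e) ^ k * dedekind_S b (nat n)"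
  using sign by (cases "even k") (auto simp: dedekind_S_minus)

text \<open>By the determinant formula, \<open>P (Suc k)\<close> and \<open>Q k\<close> are inverse modulo \<open>Q (Suc k)\<close> up to sign.\<close>

lemma dedekind_S_convergent_eq:
  "dedekind_S (P (Suc k)) (nat (Q (Suc k))) = - ((- e) ^ k) * dedekind_S (Q k) (nat (Q (Suc k)))"
proof -
  have "(- ((- e) ^ k * P (Suc k))) * Q k - 1
      = - ((- e) ^ k) * (P (Suc k) * Q k) - (- e) ^ k * (- e) ^ k"
    by (simp only: sign_power_square) simp
  also have "\<dots> = - ((- e) ^ k) * (P (Suc k) * Q k - (- ((- e) ^ k)))" by (simp add: algebra_simps)
  also have "\<dots> = - ((- e) ^ k) * (P k * Q (Suc k))" unfolding determinant[symmetric] by simp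
  finally have "Q (Suc k) dvd (- ((- e) ^ k * P (Suc k))) * Q k - 1" by simp
  from dedekind_S_inverse[OF Q_pos this]
  have "dedekind_S (Q k) (nat (Q (Suc k))) = - ((- e) ^ k) * dedekind_S (P (Suc k)) (nat (Q (Suc k)))"
    by (simp add: dedekind_S_sign_power dedekind_S_minus)
  moreover have "(- real_of_int e) ^ k * (- e) ^ k = 1"
    using sign_power_square[of k] by (metis of_int_1 of_int_minus of_int_mult of_int_power)
  ultimately show ?thesis by (simp add: mult.assoc[symmetric])
qed

text \<open>Reciprocity for two consecutive denominators, together with
  \<open>Q (Suc (Suc k))\<close> being congruent to \<open>e * Q k\<close> modulo
  \<open>Q (Suc k)\<close>, expresses \<open>?R (Suc k)\<close> through \<open>?R k\<close>. With
  the right signs this relation telescopes.\<close>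

lemma dedekind_S_convergent:
  "dedekind_S (P (Suc k)) (nat (Q (Suc k)))
     = P (Suc k) / Q (Suc k) - a 0 - ((- e) ^ k) * (Q k / Q (Suc k)) - (\<Sum>j = 1..k. (- e) ^ j * (a j - 3))"
proof (induction k)
  case 0
  show ?case
    by (simp add: P_1 Q_1 Q_0 dedekind_S_def sawtooth_def)
next
  case (Suc k)
  let ?Q0 = "real_of_int (Q k)" and ?Q1 = "real_of_int (Q (Suc k))" and ?Q2 = "real_of_int (Q (Suc (Suc k)))"
  let ?R = "\<lambda>k. dedekind_S (Q k) (nat (Q (Suc k)))"
  let ?d = "(- real_of_int e) ^ k"
  have pos: "?Q1 > 0" "?Q2 > 0" using Q_pos by simp_all
  have ee: "e * e = 1" using sign by auto
  have dd: "?d * ?d = 1"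
    using sign_power_square[of k] by (metis of_int_1 of_int_minus of_int_mult of_int_power)
  have "dedekind_S (Q (Suc (Suc k))) (nat (Q (Suc k))) = e * ?R k"
    using dedekind_S_add_mult[OF Q_pos, of "e * Q k" "a (Suc k)" k]
    by (simp add: Q_rec dedekind_S_sign add.commute)
  with dedekind_S_reciprocity[OF Q_pos Q_pos coprime_consecutive, of k]
  have rec: "?R (Suc k) = ?Q1 / ?Q2 + ?Q2 / ?Q1 + 1 / (?Q1 * ?Q2) - 3 - e * ?R k" by simp
  have "?Q2 / ?Q1 = a (Suc k) + e * (?Q0 / ?Q1)" using pos by (simp add: Q_rec field_simps)
  \<comment> \<open>By the determinant formula this reciprocity term is a difference of consecutive
    convergents; such differences add up to the last convergent minus \<open>a 0\<close>.\<close>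
  moreover have "e * ?d / (?Q1 * ?Q2) = P (Suc (Suc k)) / ?Q2 - P (Suc k) / ?Q1"
  proof -
    have "real_of_int (P (Suc (Suc k)) * Q (Suc k) - P (Suc k) * Q (Suc (Suc k))) = e * ?d"
      unfolding determinant by simp
    then show ?thesis using pos by (simp add: field_simps)
  qed
  \<comment> \<open>The factor \<open>e * ?d\<close> equals \<open>- ((- e) ^ Suc k)\<close>, the
    sign with which \<open>?R (Suc k)\<close> enters the Dedekind sum of the next
    convergent.\<close>
  ultimately have "e * ?d * ?R (Suc k) = e * ?d * (?Q1 / ?Q2) + e * ?d * (a (Suc k) - 3)
      + (e * e) * (?d * (?Q0 / ?Q1)) + (P (Suc (Suc k)) / ?Q2 - P (Suc k) / ?Q1) - (e * e) * (?d * ?R k)"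
    unfolding rec by (simp add: algebra_simps)
  then have "e * ?d * ?R (Suc k) = e * ?d * (?Q1 / ?Q2) + e * ?d * (a (Suc k) - 3)
      + ?d * (?Q0 / ?Q1) + (P (Suc (Suc k)) / ?Q2 - P (Suc k) / ?Q1) - ?d * ?R k"
    unfolding ee by simp
  moreover define T where "T = real_of_int (\<Sum>j = 1..k. (- e) ^ j * (a j - 3))"
  moreover have "?d * ?R k = a 0 - P (Suc k) / ?Q1 + ?d * (?Q0 / ?Q1) + T"
    using Suc.IH unfolding dedekind_S_convergent_eq T_def by simp
  ultimately have "e * ?d * ?R (Suc k) = P (Suc (Suc k)) / ?Q2 - a 0 + e * ?d * (?Q1 / ?Q2)
      - T + e * ?d * (a (Suc k) - 3)"
    by linarith
  then show ?case unfolding dedekind_S_convergent_eq T_def by simp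
qed

end

section \<open>Complete quotients and approximation errors\<close>

text \<open>The \<open>x k\<close> are the complete quotients. For \<open>e = -1\<close> the strict
  growth in \<open>Q_le\<close> makes \<open>Q (Suc k) + e * Q k\<close> positive, on which the
  error bounds rest.\<close>

locale continued_fraction_expansion = signed_continued_fraction +
  fixes x :: "nat \<Rightarrow> real"
  assumes x_step: "x k = a k + e / x (Suc k)"
    and x_gt_1: "x (Suc k) > 1"
    and Q_le: "e = 1 \<or> Q k < Q (Suc k)"
begin

text \<open>This is \<open>x 0 = (P (Suc k) * x (Suc k) + e * P k) / (Q (Suc k) * x (Suc k) + e * Q
  k)\<close> with the denominator cleared and the terms regrouped by errors.\<close>

lemma remainder_step: "(x 0 * Q (Suc k) - P (Suc k)) * x (Suc k) = - e * (x 0 * Q k - P k)"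
proof (induction k)
  case 0
  show ?case using x_step[of 0] x_gt_1[of 0] by (simp add: P_0 P_1 Q_0 Q_1)
next
  case (Suc k)
  let ?d = "\<lambda>k. x 0 * Q k - P k"
  have "?d (Suc (Suc k)) = a (Suc k) * ?d (Suc k) + e * ?d k"
    by (simp add: P_rec Q_rec algebra_simps)
  also have "\<dots> = ?d (Suc k) * (a (Suc k) - x (Suc k))"
    using Suc.IH by (simp add: algebra_simps)
  also have "\<dots> = - e * ?d (Suc k) / x (Suc (Suc k))"
    using x_step[of "Suc k"] by simp
  finally show ?case using x_gt_1[of "Suc k"] by simp
qed

lemma abs_remainder: "\<bar>x 0 * Q (Suc k) - P (Suc k)\<bar> * (x (Suc k) * Q (Suc k) + e * Q k) = 1"
proof -
  let ?d = "\<lambda>k. x 0 * Q k - P k"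
  have ee: "e * e = 1" using sign by auto
  have pos: "x (Suc k) * Q (Suc k) + e * Q k > 0"
  proof -
    have "real_of_int (Q (Suc k)) \<le> x (Suc k) * Q (Suc k)"
      using x_gt_1[of k] Q_pos[of k] by simp
    moreover have "Q (Suc k) + e * Q k > 0"
      using Q_le[of k] sign Q_pos Q_0 by (cases k) (auto intro: add_pos_pos)
    then have "real_of_int (Q (Suc k)) + e * Q k > 0"
      by (metis of_int_0_less_iff of_int_add of_int_mult)
    ultimately show ?thesis by linarith
  qed
  \<comment> \<open>The left side is the determinant. Inserting \<open>e * e = 1\<close> produces
    \<open>- e * ?d k\<close>, which \<open>remainder_step\<close> eliminates.\<close>
  have "?d k * Q (Suc k) - ?d (Suc k) * Q k = (e * e) * (?d k * Q (Suc k) - ?d (Suc k) * Q k)"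
    unfolding ee by simp
  also have "\<dots> = - e * ((- e * ?d k) * Q (Suc k) + e * (?d (Suc k) * Q k))"
    by (simp add: algebra_simps)
  also have "\<dots> = - e * (?d (Suc k) * (x (Suc k) * Q (Suc k) + e * Q k))"
    unfolding remainder_step[symmetric] by (simp add: algebra_simps)
  finally have "- e * (?d (Suc k) * (x (Suc k) * Q (Suc k) + e * Q k)) = real_of_int (P (Suc k) * Q k - P k * Q (Suc k))"
    by (simp add: algebra_simps)
  also have "\<bar>\<dots>\<bar> = 1" unfolding determinant using sign by (auto simp: power_abs)
  finally have "\<bar>?d (Suc k) * (x (Suc k) * Q (Suc k) + e * Q k)\<bar> = 1"
    using sign by (auto simp: abs_mult)
  then show ?thesis using pos by (simp add: abs_mult)
qed

text \<open>The cofactor of the error in \<open>abs_remainder\<close> is at least the positive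
  integer \<open>Q (Suc k) + e * Q k\<close>.\<close>

lemma abs_remainder_le: "\<bar>x 0 * Q (Suc k) - P (Suc k)\<bar> \<le> 1"
proof -
  have "real_of_int (Q (Suc k)) \<le> x (Suc k) * Q (Suc k)"
    using x_gt_1[of k] Q_pos[of k] by simp
  moreover have "Q (Suc k) + e * Q k \<ge> 1"
    using Q_le[of k] sign Q_pos Q_0 by (cases k) (auto simp: add_pos_pos int_one_le_iff_zero_less)
  then have "real_of_int (Q (Suc k)) + e * Q k \<ge> 1"
    by (metis of_int_1_le_iff of_int_add of_int_mult)
  ultimately have "x (Suc k) * Q (Suc k) + e * Q k \<ge> 1" by linarith
  then have "\<bar>x 0 * Q (Suc k) - P (Suc k)\<bar> * 1 \<le> 1"
    unfolding abs_remainder[of k, symmetric] by (intro mult_left_mono) auto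
  then show ?thesis by simp
qed

lemma convergent_bounded: "\<bar>P (Suc k) / Q (Suc k)\<bar> \<le> \<bar>x 0\<bar> + 1"
proof -
  have q: "real_of_int (Q (Suc k)) \<ge> 1" using Q_pos[of k] by simp
  have "\<bar>P (Suc k) / Q (Suc k) - x 0\<bar> = \<bar>x 0 * Q (Suc k) - P (Suc k)\<bar> / Q (Suc k)"
    using q by (simp add: field_simps abs_if)
  also have "\<dots> \<le> 1 / 1" using q abs_remainder_le by (intro frac_le) auto
  finally show ?thesis by linarith
qed

text \<open>With alternating signs the constants 3 cancel in pairs, which is why they leave no trace
  in the growth for the regular expansion.\<close>

lemma alternating_threes_bounded:
  "e = 1 \<Longrightarrow> \<bar>\<Sum>j<n. (- real_of_int e) ^ j * 3\<bar> \<le> 3"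
proof -
  have "(\<Sum>j<n. (- 1) ^ j * 3 :: real) = (if even n then 0 else 3)"
    by (induction n) auto
  then show "e = 1 \<Longrightarrow> ?thesis" by simp
qed

text \<open>In \<open>dedekind_S_convergent\<close> everything outside the digit sum is bounded. The
  shift \<open>t\<close> keeps the 3 only where it accumulates, that is for
  \<open>e = -1\<close>.\<close>

lemma dedekind_S_convergent_bounded:
  fixes t :: real
  assumes "\<And>k. Q k \<le> Q (Suc k)"
  defines "t \<equiv> if e = 1 then 0 else 3"
  shows "\<exists>C. \<forall>k. \<bar>dedekind_S (P (Suc k)) (nat (Q (Suc k)))
     + (\<Sum>j<Suc k. (- real_of_int e) ^ j * (a j - t))\<bar> \<le> C"
proof (intro exI allI)
  fix k
  define T where "T = real_of_int (\<Sum>j = 1..k. (- e) ^ j * (a j - 3))"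
  define V where "V = (\<Sum>j<Suc k. (- real_of_int e) ^ j * (3 - t))"
  define c where "c = (- e) ^ k * (Q k / Q (Suc k))"
  define p where "p = P (Suc k) / Q (Suc k)"
  have c: "\<bar>c\<bar> \<le> 1"
  proof -
    have "Q k \<ge> 0" using Q_0 Q_pos by (cases k) (auto simp: less_imp_le)
    then have "\<bar>Q k / Q (Suc k)\<bar> \<le> 1" using assms(1)[of k] Q_pos[of k] by simp
    then show ?thesis unfolding c_def using sign by (auto simp: abs_mult power_abs)
  qed
  have V: "\<bar>V\<bar> \<le> 3"
    using alternating_threes_bounded[of "Suc k"] unfolding V_def t_def
    by (cases "e = 1") simp_all
  have p: "\<bar>p\<bar> \<le> \<bar>x 0\<bar> + 1" unfolding p_def by (rule convergent_bounded)
  \<comment> \<open>The explicit formula sums from 1; the term \<open>j = 0\<close> costs the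
    constant \<open>a 0 - 3\<close>.\<close>
  have "(\<Sum>j<Suc k. (- e) ^ j * (a j - 3)) = a 0 - 3 + (\<Sum>j = 1..k. (- e) ^ j * (a j - 3))"
    by (simp add: sum.lessThan_Suc_shift sum.atLeast1_atMost_eq del: sum.lessThan_Suc power_Suc)
  then have "a 0 - 3 + T = real_of_int (\<Sum>j<Suc k. (- e) ^ j * (a j - 3))"
    unfolding T_def by simp
  also have "\<dots> = (\<Sum>j<Suc k. (- real_of_int e) ^ j * (a j - 3))"
    by simp
  also have "\<dots> = (\<Sum>j<Suc k. (- real_of_int e) ^ j * (a j - t)) - V"
    unfolding V_def sum_subtractf[symmetric] by (intro sum.cong) (auto simp: algebra_simps)
  finally have "(\<Sum>j<Suc k. (- real_of_int e) ^ j * (a j - t)) = a 0 - 3 + T + V" by simp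
  moreover have "dedekind_S (P (Suc k)) (nat (Q (Suc k))) = p - a 0 - c - T"
    unfolding dedekind_S_convergent p_def c_def T_def by simp
  \<comment> \<open>What remains is \<open>p - c - 3 + V\<close>, of absolute value at most
    \<open>(\<bar>x 0\<bar> + 1) + 1 + 3 + 3\<close>.\<close>
  ultimately show "\<bar>dedekind_S (P (Suc k)) (nat (Q (Suc k)))
     + (\<Sum>j<Suc k. (- real_of_int e) ^ j * (a j - t))\<bar> \<le> \<bar>x 0\<bar> + 8"
    using p c V by linarith
qed

end

section \<open>Regular and negative regular expansions\<close>

lemma irrational_inverse_diff:
  fixes x :: real
  assumes "x \<notin> \<rat>"
  shows "1 / (x - of_int m) \<notin> \<rat>" "1 / (of_int m - x) \<notin> \<rat>"
proof -
  have inv: "y \<in> \<rat>" if "1 / y \<in> \<rat>" for y :: real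
    using Rats_divide[OF Rats_1 that] by (simp only: div_by_1 divide_divide_eq_right mult_1_left)
  have "x \<in> \<rat>" if "x - of_int m \<in> \<rat>"
    using Rats_add[OF that Rats_of_int[of m]] by (simp only: diff_add_cancel)
  then show "1 / (x - of_int m) \<notin> \<rat>" using assms inv by metis
  have "x \<in> \<rat>" if "of_int m - x \<in> \<rat>"
    using Rats_diff[OF Rats_of_int[of m] that] by (simp only: diff_diff_eq2 add_diff_cancel_left')
  then show "1 / (of_int m - x) \<notin> \<rat>" using assms inv by metis
qed

lemma irrational_floor_ceiling:
  fixes x :: real
  assumes "x \<notin> \<rat>"
  shows "of_int \<lfloor>x\<rfloor> < x" "x < of_int \<lceil>x\<rceil>" "\<lceil>x\<rceil> = \<lfloor>x\<rfloor> + 1"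
proof -
  have ne: "x \<noteq> of_int m" for m using assms by (metis Rats_of_int)
  show "of_int \<lfloor>x\<rfloor> < x" using ne of_int_floor_le[of x] by (metis order.order_iff_strict)
  show "x < of_int \<lceil>x\<rceil>" using ne le_of_int_ceiling[of x] by (metis order.order_iff_strict)
  show "\<lceil>x\<rceil> = \<lfloor>x\<rfloor> + 1" using ne by (metis ceiling_altdef)
qed

context
  fixes z :: real
  assumes irrational: "z \<notin> \<rat>"
begin

lemma rcf_rem_irrational: "rcf_rem z j \<notin> \<rat>"
  by (induction j) (simp_all add: irrational irrational_inverse_diff)

lemma rcf_rem_gt_1: "rcf_rem z (Suc j) > 1"
  using irrational_floor_ceiling(1)[OF rcf_rem_irrational[of j]] real_of_int_floor_add_one_gt[of "rcf_rem z j"]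
  by (simp add: field_simps)

lemma rcf_rem_step: "rcf_rem z j = rcf_digit z j + 1 / rcf_rem z (Suc j)"
  by (simp add: rcf_digit_def)

lemma rcf_digit_ge_1: "rcf_digit z (Suc j) \<ge> 1"
  using rcf_rem_gt_1[of j] unfolding rcf_digit_def by simp

lemma ncf_rem_irrational: "ncf_rem z j \<notin> \<rat>"
  by (induction j) (simp_all add: irrational irrational_inverse_diff)

lemma ncf_rem_gt_1: "ncf_rem z (Suc j) > 1"
  using irrational_floor_ceiling(2)[OF ncf_rem_irrational[of j]] of_int_ceiling_diff_one_le[of "ncf_rem z j"]
    irrational_floor_ceiling(1,3)[OF ncf_rem_irrational[of j]]
  by (simp add: field_simps)

lemma ncf_rem_step: "ncf_rem z j = ncf_digit z j - 1 / ncf_rem z (Suc j)"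
  by (simp add: ncf_digit_def)

lemma ncf_digit_ge_2: "ncf_digit z (Suc j) \<ge> 2"
  using ncf_rem_gt_1[of j] unfolding ncf_digit_def by linarith

lemma rcf_den_pos_mono: "0 < rcf_den z k \<and> rcf_den z k \<le> rcf_den z (Suc k)"
proof (induction k)
  case 0
  show ?case using rcf_digit_ge_1[of 0] by simp
next
  case (Suc k)
  then have "1 * rcf_den z (Suc k) \<le> rcf_digit z (Suc (Suc k)) * rcf_den z (Suc k)"
    using rcf_digit_ge_1[of "Suc k"] by (intro mult_right_mono) auto
  with Suc show ?case unfolding rcf_den.simps by linarith
qed

text \<open>Since the digits are at least 2, the gaps between consecutive denominators never shrink,
  in spite of the minus sign in the recursion.\<close>

lemma ncf_den_pos_strict_mono: "0 < ncf_den z k \<and> ncf_den z k < ncf_den z (Suc k)"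
proof (induction k)
  case 0
  show ?case using ncf_digit_ge_2[of 0] by simp
next
  case (Suc k)
  then have "2 * ncf_den z (Suc k) \<le> ncf_digit z (Suc (Suc k)) * ncf_den z (Suc k)"
    using ncf_digit_ge_2[of "Suc k"] by (intro mult_right_mono) auto
  with Suc show ?case unfolding ncf_den.simps by linarith
qed

text \<open>\<open>case_nat\<close> prepends the values 1 and 0 belonging to index
  \<open>-1\<close>, which matches the index shift of the locale.\<close>

lemma rcf_expansion:
  "continued_fraction_expansion 1 (rcf_digit z) (case_nat 1 (rcf_num z)) (case_nat 0 (rcf_den z)) (rcf_rem z)"
proof unfold_locales
  show "case_nat 1 (rcf_num z) (Suc (Suc k))
      = rcf_digit z (Suc k) * case_nat 1 (rcf_num z) (Suc k) + 1 * case_nat 1 (rcf_num z) k" for k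
    by (cases k) auto
  show "case_nat 0 (rcf_den z) (Suc (Suc k))
      = rcf_digit z (Suc k) * case_nat 0 (rcf_den z) (Suc k) + 1 * case_nat 0 (rcf_den z) k" for k
    by (cases k) auto
  show "rcf_rem z k = rcf_digit z k + of_int 1 / rcf_rem z (Suc k)" for k
    using rcf_rem_step[of k] by simp
qed (use rcf_den_pos_mono rcf_rem_gt_1 in \<open>auto simp del: rcf_rem.simps\<close>)

lemma ncf_expansion:
  "continued_fraction_expansion (- 1) (ncf_digit z) (case_nat 1 (ncf_num z)) (case_nat 0 (ncf_den z)) (ncf_rem z)"
proof unfold_locales
  show "case_nat 1 (ncf_num z) (Suc (Suc k))
      = ncf_digit z (Suc k) * case_nat 1 (ncf_num z) (Suc k) + - 1 * case_nat 1 (ncf_num z) k" for k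
    by (cases k) auto
  show "case_nat 0 (ncf_den z) (Suc (Suc k))
      = ncf_digit z (Suc k) * case_nat 0 (ncf_den z) (Suc k) + - 1 * case_nat 0 (ncf_den z) k" for k
    by (cases k) auto
  show "ncf_rem z k = ncf_digit z k + of_int (- 1) / ncf_rem z (Suc k)" for k
    using ncf_rem_step[of k] by simp
  show "- 1 = (1 :: int) \<or> (case k of 0 \<Rightarrow> 0 | Suc j \<Rightarrow> ncf_den z j) < (case Suc k of 0 \<Rightarrow> 0 | Suc j \<Rightarrow> ncf_den z j)" for k
    using ncf_den_pos_strict_mono by (cases k) auto
qed (use ncf_den_pos_strict_mono ncf_rem_gt_1 in \<open>auto simp del: ncf_rem.simps\<close>)

lemma rcf_S_bounded: "\<exists>C. \<forall>k. \<bar>rcf_S z k + (\<Sum>j<Suc k. (- 1) ^ j * real_of_int (rcf_digit z j))\<bar> \<le> C"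
proof -
  interpret continued_fraction_expansion 1 "rcf_digit z" "case_nat 1 (rcf_num z)" "case_nat 0 (rcf_den z)" "rcf_rem z"
    by (rule rcf_expansion)
  have "case_nat 0 (rcf_den z) k \<le> case_nat 0 (rcf_den z) (Suc k)" for k
    using rcf_den_pos_mono by (cases k) auto
  from dedekind_S_convergent_bounded[OF this] show ?thesis by (simp add: rcf_S_def del: sum.lessThan_Suc)
qed

lemma ncf_S_bounded: "\<exists>C. \<forall>k. \<bar>ncf_S z k + (\<Sum>j<Suc k. real_of_int (ncf_digit z j) - 3)\<bar> \<le> C"
proof -
  interpret continued_fraction_expansion "- 1" "ncf_digit z" "case_nat 1 (ncf_num z)" "case_nat 0 (ncf_den z)" "ncf_rem z"
    by (rule ncf_expansion)
  have "case_nat 0 (ncf_den z) k \<le> case_nat 0 (ncf_den z) (Suc k)" for k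
    using ncf_den_pos_strict_mono by (cases k) (auto simp: less_imp_le)
  from dedekind_S_convergent_bounded[OF this] show ?thesis by (simp add: ncf_S_def del: sum.lessThan_Suc)
qed

end

section \<open>Lagrange's theorem\<close>

text \<open>If one root \<open>p / q\<close> is rational, so is the other, because the sum of the
  roots is; but \<open>z\<close> is one of the two. The factorization in the proof exhibits both
  candidates for \<open>z\<close>.\<close>

lemma rational_not_quadratic_root:
  fixes z :: real and a b c p q :: int
  assumes "z \<notin> \<rat>" "a \<noteq> 0" "of_int a * z\<^sup>2 + of_int b * z + of_int c = 0" "q \<noteq> 0"
  shows "a * p\<^sup>2 + b * p * q + c * q\<^sup>2 \<noteq> 0"
proof
  assume 0: "a * p\<^sup>2 + b * p * q + c * q\<^sup>2 = 0"
  have "(q * z - p) * (a * (q * z + p) + b * q)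
      = q\<^sup>2 * (a * z\<^sup>2 + b * z + c) - (a * p\<^sup>2 + b * p * q + c * q\<^sup>2)"
    by (simp add: algebra_simps power2_eq_square)
  also have "\<dots> = 0" unfolding assms(3) 0 by simp
  finally consider "q * z - p = 0" | "a * (q * z + p) + b * q = 0"
    by (metis mult_eq_0_iff)
  then have "z = of_int p / of_int q \<or> z = of_int (- (a * p + b * q)) / of_int (a * q)"
    using assms(2,4) by cases (auto simp: field_simps)
  then show False using assms(1) by (metis Rats_divide Rats_of_int)
qed

lemma rcf_rem_eventually_periodic:
  assumes "quadratic_irrational z"
  shows "\<exists>n l. periodic_from (rcf_rem z) n l"
proof -
  from assms obtain a b c :: int where irr: "z \<notin> \<rat>" and a: "a \<noteq> 0"
    and eq: "of_int a * z\<^sup>2 + of_int b * z + of_int c = 0"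
    unfolding quadratic_irrational_def by blast
  define P where "P = case_nat 1 (rcf_num z)"
  define Q where "Q = case_nat 0 (rcf_den z)"
  interpret continued_fraction_expansion 1 "rcf_digit z" P Q "rcf_rem z"
    unfolding P_def Q_def by (rule rcf_expansion[OF irr])
  \<comment> \<open>The complete quotients are roots of integral quadratic polynomials with coefficients
    \<open>A (Suc k), B k, A k\<close>, constant discriminant, and bounded \<open>A\<close>: they take only finitely many values.\<close>
  define A where "A k = a * (P k)\<^sup>2 + b * P k * Q k + c * (Q k)\<^sup>2" for k
  define B where "B k = 2 * a * P (Suc k) * P k + b * (P (Suc k) * Q k + P k * Q (Suc k)) + 2 * c * Q (Suc k) * Q k" for k
  define x where "x k = rcf_rem z (Suc k)" for k
  define \<Delta> where "\<Delta> = b\<^sup>2 - 4 * a * c"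
  define M where "M = \<lceil>\<bar>2 * a * z + b\<bar>\<rceil> + \<bar>a\<bar>"
  have A_nonzero: "A (Suc k) \<noteq> 0" for k
    unfolding A_def using rational_not_quadratic_root[OF irr a eq] Q_pos[of k] by simp
  \<comment> \<open>The coefficients arise from a linear substitution, which multiplies the
    discriminant by the square of its determinant, here 1.\<close>
  have disc: "(B k)\<^sup>2 = \<Delta> + 4 * A (Suc k) * A k" for k
  proof -
    have "(B k)\<^sup>2 - 4 * A (Suc k) * A k = \<Delta> * (P (Suc k) * Q k - P k * Q (Suc k))\<^sup>2"
      unfolding A_def B_def \<Delta>_def by (simp add: algebra_simps power2_eq_square)
    also have "\<dots> = \<Delta>" using sign_power_square[of k] unfolding determinant power2_eq_square by simp
    finally show ?thesis by simp
  qed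
  \<comment> \<open>Substituting \<open>z = (P (Suc k) * x k + P k) / W\<close> into the equation of
    \<open>z\<close> and multiplying by \<open>W\<^sup>2\<close> gives the equation of
    \<open>x k\<close>.\<close>
  have root: "A (Suc k) * (x k)\<^sup>2 + B k * x k + A k = 0" for k
  proof -
    define W where "W = Q (Suc k) * x k + Q k"
    have PW: "P (Suc k) * x k + P k = z * W"
      using remainder_step[of k] unfolding W_def x_def by (simp add: algebra_simps del: rcf_rem.simps(2))
    have "A (Suc k) * (x k)\<^sup>2 + B k * x k + A k
        = a * (P (Suc k) * x k + P k)\<^sup>2 + b * (P (Suc k) * x k + P k) * W + c * W\<^sup>2"
      unfolding A_def B_def W_def by (simp add: algebra_simps power2_eq_square)
    also have "\<dots> = W\<^sup>2 * (a * z\<^sup>2 + b * z + c)" unfolding PW by (simp add: algebra_simps power2_eq_square)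
    finally show ?thesis unfolding eq by simp
  qed
  have A_bound: "\<bar>A (Suc k)\<bar> \<le> M" for k
  proof -
    \<comment> \<open>Expanding the quadratic form at \<open>P (Suc k) = z * Q (Suc k) - d\<close>
      kills the main part; the rest is controlled by
      \<open>\<bar>d * Q (Suc k)\<bar> \<le> 1\<close> and \<open>\<bar>d\<bar> \<le> 1\<close>.
      This is the origin of \<open>M\<close>.\<close>
    define d where "d = z * Q (Suc k) - P (Suc k)"
    have d1: "\<bar>d\<bar> \<le> 1" using abs_remainder_le[of k] by (simp add: d_def)
    have q: "real_of_int (Q (Suc k)) \<ge> 1" using Q_pos[of k] by simp
    have "\<bar>d\<bar> * Q (Suc k) \<le> \<bar>d\<bar> * (rcf_rem z (Suc k) * Q (Suc k) + 1 * Q k)"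
    proof (rule mult_left_mono)
      have "1 * real_of_int (Q (Suc k)) \<le> rcf_rem z (Suc k) * Q (Suc k)"
        using x_gt_1[of k] q by (intro mult_right_mono) auto
      moreover have "Q k \<ge> 0" using Q_0 Q_pos by (cases k) (auto simp: less_imp_le)
      ultimately show "real_of_int (Q (Suc k)) \<le> rcf_rem z (Suc k) * Q (Suc k) + 1 * Q k" by simp
    qed simp
    then have dq: "\<bar>d * Q (Suc k)\<bar> \<le> 1"
      using abs_remainder[of k] q by (simp add: d_def abs_mult)
    have P_eq: "P (Suc k) = z * Q (Suc k) - d" by (simp add: d_def)
    have "real_of_int (A (Suc k)) = (Q (Suc k))\<^sup>2 * (a * z\<^sup>2 + b * z + c)
        - (d * Q (Suc k)) * (2 * a * z + b) + a * d\<^sup>2"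
      unfolding A_def of_int_add of_int_mult of_int_power P_eq
      by (simp add: algebra_simps power2_eq_square)
    then have "real_of_int (A (Suc k)) = a * d\<^sup>2 - (d * Q (Suc k)) * (2 * a * z + b)"
      unfolding eq by simp
    moreover have "\<bar>(d * Q (Suc k)) * (2 * a * z + b)\<bar> \<le> 1 * \<bar>2 * a * z + b\<bar>"
      unfolding abs_mult[of "d * Q (Suc k)"] by (rule mult_right_mono[OF dq]) simp
    moreover have "\<bar>a * d\<^sup>2\<bar> \<le> \<bar>real_of_int a\<bar> * 1"
      unfolding abs_mult using d1 by (intro mult_left_mono) (auto simp: abs_square_le_1)
    moreover have "\<bar>u - v\<bar> \<le> s + r" if "\<bar>v\<bar> \<le> 1 * s" "\<bar>u\<bar> \<le> r * 1" for u v r s :: real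
      using that by linarith
    ultimately have "\<bar>real_of_int (A (Suc k))\<bar> \<le> \<bar>2 * a * z + b\<bar> + \<bar>real_of_int a\<bar>" by metis
    then have "real_of_int \<bar>A (Suc k)\<bar> \<le> of_int M"
      unfolding M_def of_int_add of_int_abs by (rule order_trans[OF _ add_right_mono[OF le_of_int_ceiling]])
    then show ?thesis by simp
  qed
  have B_bound: "\<bar>B (Suc k)\<bar> \<le> \<bar>\<Delta>\<bar> + 4 * M * M" for k
  proof -
    have "A (Suc (Suc k)) * A (Suc k) \<le> \<bar>A (Suc (Suc k))\<bar> * \<bar>A (Suc k)\<bar>"
      by (simp add: abs_mult[symmetric])
    also have "\<dots> \<le> M * M" using A_bound[of k] by (intro mult_mono A_bound) auto
    finally have "(B (Suc k))\<^sup>2 \<le> \<bar>\<Delta>\<bar> + 4 * M * M" unfolding disc by simp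
    moreover have "\<bar>B (Suc k)\<bar> \<le> (B (Suc k))\<^sup>2"
      using self_le_power[of "\<bar>B (Suc k)\<bar>" 2] by (cases "B (Suc k) = 0") auto
    ultimately show ?thesis by simp
  qed
  \<comment> \<open>The quadratic formula, with \<open>s\<close> as the sign of the square
    root.\<close>
  define f :: "real \<Rightarrow> int \<Rightarrow> int \<Rightarrow> real" where "f s \<beta> \<alpha> = (s * sqrt \<Delta> - \<beta>) / (2 * \<alpha>)" for s \<beta> \<alpha>
  define N where "N = \<bar>\<Delta>\<bar> + 4 * M * M"
  have "x (Suc k) \<in> (\<lambda>(s, \<beta>, \<alpha>). f s \<beta> \<alpha>) ` ({1, -1} \<times> {- N..N} \<times> {- M..M})" for k
  proof -
    let ?\<alpha> = "A (Suc (Suc k))" and ?\<beta> = "B (Suc k)" and ?x = "x (Suc k)"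
    have "(2 * ?\<alpha> * ?x + ?\<beta>)\<^sup>2 = 4 * ?\<alpha> * (?\<alpha> * ?x\<^sup>2 + ?\<beta> * ?x + A (Suc k)) + of_int (?\<beta>\<^sup>2 - 4 * ?\<alpha> * A (Suc k))"
      by (simp add: algebra_simps power2_eq_square)
    also have "\<dots> = \<Delta>" unfolding root disc by simp
    finally have "\<bar>2 * ?\<alpha> * ?x + ?\<beta>\<bar> = sqrt \<Delta>" by (metis real_sqrt_abs)
    then have "2 * ?\<alpha> * ?x + ?\<beta> = 1 * sqrt \<Delta> \<or> 2 * ?\<alpha> * ?x + ?\<beta> = - 1 * sqrt \<Delta>"
      unfolding abs_eq_iff' by simp
    then obtain s :: real where s: "s \<in> {1, -1}" "2 * ?\<alpha> * ?x + ?\<beta> = s * sqrt \<Delta>"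
      by blast
    then have "?x = f s ?\<beta> ?\<alpha>" unfolding f_def using A_nonzero[of "Suc k"] by (simp add: field_simps)
    moreover have "?\<beta> \<in> {- N..N}" "?\<alpha> \<in> {- M..M}"
      using B_bound[of k] A_bound[of "Suc k"] by (auto simp: N_def)
    ultimately show ?thesis using s(1) by (intro image_eqI[of _ _ "(s, ?\<beta>, ?\<alpha>)"]) simp_all
  qed
  then have "range (\<lambda>k. x (Suc k)) \<subseteq> (\<lambda>(s, \<beta>, \<alpha>). f s \<beta> \<alpha>) ` ({1, -1} \<times> {- N..N} \<times> {- M..M})"
    by blast
  then have "finite (range (\<lambda>k. x (Suc k)))"
    by (rule finite_subset) (intro finite_imageI finite_cartesian_product finite.intros finite_atLeastAtMost_int)
  then have "\<not> inj (\<lambda>k. x (Suc k))" using finite_imageD infinite_UNIV_nat by blast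
  then obtain i j where "i < j" and ij: "x (Suc i) = x (Suc j)"
    unfolding inj_def by (metis nat_neq_iff)
  \<comment> \<open>Each complete quotient determines the next, so a single coincidence
    propagates.\<close>
  have "rcf_rem z (Suc (Suc i) + t + (j - i)) = rcf_rem z (Suc (Suc i) + t)" for t
    using ij \<open>i < j\<close> by (induction t) (simp_all add: x_def)
  then have "periodic_from (rcf_rem z) (Suc (Suc i)) (j - i)"
    unfolding periodic_from_def using \<open>i < j\<close> by (metis le_add_diff_inverse zero_less_diff)
  then show ?thesis by blast
qed

section \<open>Comparison of the two expansions\<close>

context
  fixes z :: real
  assumes irrational: "z \<notin> \<rat>"
begin

lemmas rcf_gt_1 = rcf_rem_gt_1[OF irrational]

text \<open>A remainder \<open>1 + 1 / y\<close> with \<open>y > 1\<close> has ceiling 2 and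
  successor \<open>1 + 1 / (y - 1)\<close>. Starting at \<open>y = ?x - 1\<close>, this goes on
  until \<open>rcf_digit z (Suc u)\<close> has been subtracted from \<open>?x\<close>.\<close>

lemma ncf_rem_block:
  assumes start: "ncf_rem z n = rcf_rem z u + of_int s"
    and k: "k < nat (rcf_digit z (Suc u))"
  shows "ncf_rem z (Suc (n + k)) = 1 + 1 / (rcf_rem z (Suc u) - of_nat (Suc k))"
    and "ncf_digit z (n + k) = (if k = 0 then rcf_digit z u + s + 1 else 2)"
proof -
  let ?x = "rcf_rem z (Suc u)"
  have gt: "?x - of_nat (Suc k) > 0" if "k < nat (rcf_digit z (Suc u))" for k
  proof -
    have "of_int (rcf_digit z (Suc u)) < ?x"
      unfolding rcf_digit_def by (rule irrational_floor_ceiling(1)[OF rcf_rem_irrational[OF irrational]])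
    moreover have "int (Suc k) \<le> rcf_digit z (Suc u)" using that by linarith
    then have "real (Suc k) \<le> of_int (rcf_digit z (Suc u))" by linarith
    ultimately show ?thesis by simp
  qed
  have "ncf_rem z (Suc (n + k)) = 1 + 1 / (?x - of_nat (Suc k)) \<and>
        ncf_digit z (n + k) = (if k = 0 then rcf_digit z u + s + 1 else 2)"
    using k
  proof (induction k)
    case 0
    have "\<lceil>rcf_rem z u\<rceil> = rcf_digit z u + 1"
      unfolding rcf_digit_def by (rule irrational_floor_ceiling(3)[OF rcf_rem_irrational[OF irrational]])
    then have dig: "ncf_digit z n = rcf_digit z u + s + 1" by (simp add: ncf_digit_def start)
    have gap: "ncf_digit z n - ncf_rem z n = 1 - 1 / ?x"
      unfolding dig start rcf_rem_step[OF irrational, of u] by (simp del: rcf_rem.simps)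
    have "ncf_rem z (Suc n) = 1 / (ncf_digit z n - ncf_rem z n)" by (simp add: ncf_digit_def)
    also have "\<dots> = 1 + 1 / (?x - 1)"
      unfolding gap using rcf_gt_1[of u] by (simp add: field_simps del: rcf_rem.simps)
    finally show ?case using dig by (simp del: rcf_rem.simps ncf_rem.simps)
  next
    case (Suc k)
    define y where "y = ?x - of_nat (Suc k)"
    have y: "y > 1" using gt[OF Suc.prems] by (simp add: y_def del: rcf_rem.simps)
    have rem: "ncf_rem z (n + Suc k) = 1 + 1 / y" using Suc by (simp add: y_def del: rcf_rem.simps ncf_rem.simps)
    have "\<lceil>1 + 1 / y\<rceil> = 2" using y by (simp add: ceiling_eq_iff field_simps)
    then have dig: "ncf_digit z (n + Suc k) = 2" unfolding ncf_digit_def rem .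
    have "ncf_rem z (Suc (n + Suc k)) = 1 / (ncf_digit z (n + Suc k) - ncf_rem z (n + Suc k))"
      by (simp add: ncf_digit_def)
    also have "\<dots> = 1 / (1 - 1 / y)" unfolding dig rem by simp
    also have "\<dots> = 1 + 1 / (y - 1)" using y by (simp add: field_simps)
    finally show ?case using dig by (simp add: y_def algebra_simps del: rcf_rem.simps ncf_rem.simps)
  qed
  then show "ncf_rem z (Suc (n + k)) = 1 + 1 / (rcf_rem z (Suc u) - of_nat (Suc k))"
    "ncf_digit z (n + k) = (if k = 0 then rcf_digit z u + s + 1 else 2)" by blast+
qed

text \<open>The first digit of the block exceeds 3 by \<open>rcf_digit z u + s - 2\<close>, and each
  of the \<open>rcf_digit z (Suc u) - 1\<close> twos contributes \<open>-1\<close>. The final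
  remainder has the required form for a further block, with shift 1.\<close>

lemma ncf_block_end:
  assumes start: "ncf_rem z n = rcf_rem z u + of_int s"
  defines "m \<equiv> n + nat (rcf_digit z (Suc u))"
  shows "ncf_rem z m = rcf_rem z (Suc (Suc u)) + 1"
    and "(\<Sum>j<m. ncf_digit z j - 3) = (\<Sum>j<n. ncf_digit z j - 3)
           + rcf_digit z u - rcf_digit z (Suc u) + s - 1"
proof -
  define a where "a = nat (rcf_digit z (Suc u))"
  have a: "a \<ge> 1" "int a = rcf_digit z (Suc u)"
    using rcf_digit_ge_1[OF irrational, of u] by (auto simp: a_def)
  then obtain k where k: "a = Suc k" by (cases a) auto
  have "ncf_rem z m = ncf_rem z (Suc (n + k))" by (simp add: m_def a_def[symmetric] k)
  also have "\<dots> = 1 + 1 / (rcf_rem z (Suc u) - of_nat a)"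
    unfolding k using k by (intro ncf_rem_block(1)[OF start]) (simp add: a_def[symmetric])
  also have "of_nat a = real_of_int (rcf_digit z (Suc u))" using a(2) by (metis of_int_of_nat_eq)
  finally show "ncf_rem z m = rcf_rem z (Suc (Suc u)) + 1" by (simp add: rcf_digit_def)
  have "(\<Sum>j<n + Suc t. ncf_digit z j - 3) = (\<Sum>j<n. ncf_digit z j - 3) + rcf_digit z u + s - 2 - t"
    if "t \<le> k" for t
    using that
  proof (induction t)
    case 0
    then show ?case using ncf_rem_block(2)[OF start, of 0] k by (simp add: a_def[symmetric])
  next
    case (Suc t)
    then show ?case using ncf_rem_block(2)[OF start, of "Suc t"] k by (simp add: a_def[symmetric])
  qed
  from this[of k] a(2) show "(\<Sum>j<m. ncf_digit z j - 3) = (\<Sum>j<n. ncf_digit z j - 3)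
           + rcf_digit z u - rcf_digit z (Suc u) + s - 1"
    unfolding m_def a_def[symmetric] k by simp
qed

text \<open>The index in the negative regular expansion where the block for the regular digits
  \<open>2 * i\<close> and \<open>2 * i + 1\<close> begins. The digits summed have odd index, so
  they are positive and \<open>nat\<close> is harmless.\<close>

definition block_start :: "nat \<Rightarrow> nat" where
  "block_start i = (\<Sum>k<i. nat (rcf_digit z (Suc (2 * k))))"

lemma block_start_Suc: "block_start i < block_start (Suc i)"
  using rcf_digit_ge_1[OF irrational, of "2 * i"] by (simp add: block_start_def)

lemma strict_mono_block_start: "strict_mono block_start"
  by (rule strict_mono_Suc_iff[THEN iffD2]) (simp add: block_start_Suc)

text \<open>The first block has shift 0 and all later ones shift 1, so the defect \<open>-1\<close>
  arises once and does not accumulate.\<close>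

lemma ncf_at_block_start:
  "ncf_rem z (block_start (Suc i)) = rcf_rem z (2 * Suc i) + 1"
  "(\<Sum>j<block_start (Suc i). ncf_digit z j - 3) = (\<Sum>j<2 * Suc i. (- 1) ^ j * rcf_digit z j) - 1"
proof (induction i)
  case 0
  have start: "ncf_rem z 0 = rcf_rem z 0 + of_int 0" by simp
  { case 1 show ?case using ncf_block_end(1)[OF start] by (simp add: block_start_def numeral_2_eq_2 del: rcf_rem.simps ncf_rem.simps) }
  { case 2 show ?case using ncf_block_end(2)[OF start] by (simp add: block_start_def numeral_2_eq_2 del: rcf_rem.simps ncf_rem.simps) }
next
  case (Suc i)
  have start: "ncf_rem z (block_start (Suc i)) = rcf_rem z (2 * Suc i) + of_int 1" using Suc(1) by simp
  have step: "block_start (Suc (Suc i)) = block_start (Suc i) + nat (rcf_digit z (Suc (2 * Suc i)))"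
    by (simp add: block_start_def)
  have two: "2 * Suc (Suc i) = Suc (Suc (2 * Suc i))" by simp
  { case 1 show ?case using ncf_block_end(1)[OF start] unfolding step two . }
  { case 2
    have "(\<Sum>j<block_start (Suc (Suc i)). ncf_digit z j - 3)
      = (\<Sum>j<2 * Suc i. (- 1) ^ j * rcf_digit z j) - 1 + rcf_digit z (2 * Suc i) - rcf_digit z (Suc (2 * Suc i))"
      using ncf_block_end(2)[OF start] Suc(2) unfolding step by linarith
    also have "\<dots> = (\<Sum>j<2 * Suc (Suc i). (- 1) ^ j * rcf_digit z j) - 1"
      unfolding two sum.lessThan_Suc[of _ "Suc (2 * Suc i)"] sum.lessThan_Suc[of _ "2 * Suc i"] by simp
    finally show ?case . }
qed

end

section \<open>Periodic sequences and linear growth of partial sums\<close>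

lemma periodic_from_mult:
  assumes "periodic_from x n l" "0 < k"
  shows "periodic_from x n (k * l)"
proof -
  have "x (j + k * l) = x j" if "j \<ge> n" for j
  proof (induction k)
    case (Suc k)
    have "x (j + k * l + l) = x (j + k * l)" using assms(1) that by (simp add: periodic_from_def)
    then show ?case using Suc by (simp add: algebra_simps)
  qed simp
  then show ?thesis using assms by (simp add: periodic_from_def)
qed

text \<open>Block starts see the regular remainders at even indices only, so the period is doubled:
  advancing by \<open>l\<close> blocks shifts the regular index by \<open>2 * l\<close>, which
  reproduces the remainder.\<close>

lemma ncf_rem_eventually_periodic:
  assumes "z \<notin> \<rat>" "periodic_from (rcf_rem z) n l"
  shows "\<exists>n l. periodic_from (ncf_rem z) n l"
proof -
  define m where "m = block_start z (Suc n)"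
  define m' where "m' = block_start z (Suc (n + l))"
  have "0 < l" using assms(2) by (simp add: periodic_from_def)
  then have "m < m'" unfolding m_def m'_def
    using strict_mono_block_start[OF assms(1)] by (simp add: strict_mono_def)
  have "n \<le> 2 * Suc n" by simp
  then have "rcf_rem z (2 * Suc n + 2 * l) = rcf_rem z (2 * Suc n)"
    using periodic_from_mult[OF assms(2) pos2] unfolding periodic_from_def by blast
  then have eq: "ncf_rem z m' = ncf_rem z m"
    unfolding m_def m'_def ncf_at_block_start(1)[OF assms(1)] by (simp add: algebra_simps del: rcf_rem.simps)
  have "ncf_rem z (m + t + (m' - m)) = ncf_rem z (m + t)" for t
    using eq \<open>m < m'\<close> by (induction t) simp_all
  then have "periodic_from (ncf_rem z) m (m' - m)"
    unfolding periodic_from_def using \<open>m < m'\<close> by (metis le_add_diff_inverse zero_less_diff)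
  then show ?thesis by blast
qed

lemma periodic_from_comp: "periodic_from x n l \<Longrightarrow> periodic_from (\<lambda>j. f (x j)) n l"
  by (simp add: periodic_from_def)

lemma periodic_from_period_length:
  assumes "periodic_from x n l"
  shows "periodic_from x (preperiod_length x) (period_length x)"
proof -
  have "\<exists>n. periodic_from x n (period_length x)"
    unfolding period_length_def by (rule LeastI[of "\<lambda>l. \<exists>n. periodic_from x n l"]) (use assms in blast)
  then show ?thesis unfolding preperiod_length_def by (rule LeastI_ex)
qed

text \<open>A full period adds \<open>l * \<mu>\<close> wherever it starts, so the deviation
  \<open>g\<close> from linear growth is itself eventually periodic and takes finitely many
  values.\<close>

lemma periodic_sum_bounded:
  fixes w :: "nat \<Rightarrow> real"
  assumes "periodic_from w n l"
  shows "\<exists>C. \<forall>N. \<bar>(\<Sum>j<N. w j) - N * ((\<Sum>j<l. w (n + j)) / l)\<bar> \<le> C"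
proof -
  define \<mu> where "\<mu> = (\<Sum>j<l. w (n + j)) / l"
  define g where "g N = (\<Sum>j<N. w j) - N * \<mu>" for N
  have l: "l > 0" using assms by (simp add: periodic_from_def)
  have per: "w (j + l) = w j" if "j \<ge> n" for j
    using assms that by (simp add: periodic_from_def)
  have shift: "(\<Sum>j<n + t + l. w j) = (\<Sum>j<n + t. w j) + l * \<mu>" for t
  proof (induction t)
    case 0
    have "(\<Sum>j<n + k. w j) = (\<Sum>j<n. w j) + (\<Sum>j<k. w (n + j))" for k
      by (induction k) simp_all
    then show ?case using l by (simp add: \<mu>_def)
  next
    case (Suc t)
    then show ?case using per[of "n + t"] by simp
  qed
  have g_per: "g (N + l) = g N" if "N \<ge> n" for N
    using shift[of "N - n"] that by (simp add: g_def algebra_simps)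
  have "g N \<in> g ` {..<n + l}" for N
  proof (induction N rule: less_induct)
    case (less N)
    show ?case
    proof (cases "N < n + l")
      case False
      then have "g N = g (N - l)" using g_per[of "N - l"] by simp
      then show ?thesis using less[of "N - l"] False l by simp
    qed simp
  qed
  then have "\<bar>g N\<bar> \<le> Max (abs ` g ` {..<n + l})" for N
    by (intro Max_ge) auto
  then show ?thesis unfolding g_def \<mu>_def by blast
qed

lemma linear_growth:
  fixes f :: "nat \<Rightarrow> real" and c K :: real
  assumes "\<And>k. \<bar>f k - Suc k * c\<bar> \<le> K"
  shows "c > 0 \<Longrightarrow> filterlim f at_top sequentially"
    and "c = 0 \<Longrightarrow> Bseq f"
    and "c < 0 \<Longrightarrow> filterlim f at_bot sequentially"
proof -
  have top: "filterlim g at_top sequentially"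
    if "c > 0" "\<And>k. \<bar>g k - Suc k * c\<bar> \<le> K" for g :: "nat \<Rightarrow> real" and c :: real
  proof (rule filterlim_at_top_mono)
    show "filterlim (\<lambda>k. - (K - c) + c * real k) at_top sequentially"
      by (rule filterlim_tendsto_add_at_top[OF tendsto_const
          filterlim_tendsto_pos_mult_at_top[OF tendsto_const \<open>c > 0\<close> filterlim_real_sequentially]])
    show "\<forall>\<^sub>F k in sequentially. - (K - c) + c * real k \<le> g k"
    proof (rule always_eventually, rule allI)
      fix k
      show "- (K - c) + c * real k \<le> g k" using that(2)[of k] by (simp add: algebra_simps abs_le_iff)
    qed
  qed
  show "c > 0 \<Longrightarrow> filterlim f at_top sequentially" using top[of c f] assms by blast
  show "c = 0 \<Longrightarrow> Bseq f" using assms by (intro BseqI'[of f K]) simp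
  show "filterlim f at_bot sequentially" if "c < 0"
  proof -
    have "\<bar>- f k - Suc k * (- c)\<bar> \<le> K" for k using assms[of k] by (simp add: abs_minus_commute)
    then show ?thesis using top[of "- c" "\<lambda>k. - f k"] that by (simp add: filterlim_uminus_at_bot)
  qed
qed

text \<open>If \<open>\<beta> \<le> 0\<close>, then \<open>N i * \<alpha>\<close> would stay below
  \<open>K\<close> although it is at least \<open>i * \<alpha>\<close>. The ratio of
  \<open>M\<close> and \<open>N\<close> is left open, so only the sign is transferred.\<close>

lemma comparable_growth_pos:
  fixes \<alpha> \<beta> :: real and M N :: "nat \<Rightarrow> nat"
  assumes "\<And>i. \<bar>N i * \<alpha> - M i * \<beta>\<bar> \<le> K" "\<And>i. i \<le> N i" "\<alpha> > 0"
  shows "\<beta> > 0"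
proof (rule ccontr)
  assume "\<not> \<beta> > 0"
  obtain i :: nat where i: "K < i * \<alpha>" using reals_Archimedean3[OF \<open>\<alpha> > 0\<close>] by blast
  have "i * \<alpha> \<le> N i * \<alpha>" using assms(2)[of i] \<open>\<alpha> > 0\<close> by simp
  moreover have "M i * \<beta> \<le> 0" using \<open>\<not> \<beta> > 0\<close> by (simp add: mult_nonneg_nonpos)
  ultimately show False using i assms(1)[of i] by linarith
qed

lemma comparable_growth_sgn:
  fixes \<alpha> \<beta> :: real and M N :: "nat \<Rightarrow> nat"
  assumes "\<And>i. \<bar>N i * \<alpha> - M i * \<beta>\<bar> \<le> K" "\<And>i. i \<le> N i" "\<And>i. i \<le> M i"
  shows "\<alpha> > 0 \<longleftrightarrow> \<beta> > 0" "\<alpha> < 0 \<longleftrightarrow> \<beta> < 0"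
proof -
  have sym: "\<bar>M i * \<beta> - N i * \<alpha>\<bar> \<le> K" and neg: "\<bar>N i * (- \<alpha>) - M i * (- \<beta>)\<bar> \<le> K"
    and symneg: "\<bar>M i * (- \<beta>) - N i * (- \<alpha>)\<bar> \<le> K" for i
    using assms(1)[of i] by (simp_all add: abs_minus_commute)
  show "\<alpha> > 0 \<longleftrightarrow> \<beta> > 0"
    using comparable_growth_pos[OF assms(1,2)] comparable_growth_pos[OF sym assms(3)] by blast
  show "\<alpha> < 0 \<longleftrightarrow> \<beta> < 0"
    using comparable_growth_pos[OF neg assms(2)] comparable_growth_pos[OF symneg assms(3)] by auto
qed

text \<open>Evenness makes the signs \<open>(- 1) ^ j\<close> repeat together with the
  digits.\<close>

lemma rcf_even_period_periodic:
  assumes "periodic_from (rcf_digit z) n l"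
  shows "even (rcf_even_period z)"
    and "periodic_from (rcf_digit z) (preperiod_length (rcf_digit z)) (rcf_even_period z)"
  using periodic_from_period_length[OF assms] periodic_from_mult[OF periodic_from_period_length[OF assms], of 2]
  by (auto simp: rcf_even_period_def Let_def)

lemma rcf_alternating_sum_bounded:
  assumes "periodic_from (rcf_digit z) n l"
  shows "\<exists>C. \<forall>N. \<bar>(\<Sum>j<N. (- 1) ^ j * real_of_int (rcf_digit z j))
           + N * (rcf_alternating_sum z / rcf_even_period z)\<bar> \<le> C"
proof -
  define n where "n = preperiod_length (rcf_digit z)"
  define L where "L = rcf_even_period z"
  have per: "periodic_from (\<lambda>j. (- 1) ^ j * real_of_int (rcf_digit z j)) n L"
    using rcf_even_period_periodic[OF assms] by (auto simp: periodic_from_def n_def L_def power_add)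
  \<comment> \<open>The sign exponents \<open>n + 1\<close> and \<open>j - 1\<close> for the entry
    at index \<open>n + j - 1\<close> differ by one from that index: hence minus the sum over a
    period, and a plus sign in the claim.\<close>
  have "real_of_int (rcf_alternating_sum z) = - (\<Sum>j<L. (- 1) ^ (n + j) * real_of_int (rcf_digit z (n + j)))"
    by (simp add: rcf_alternating_sum_def period_entry_def n_def L_def sum.atLeast1_atMost_eq
        sum_distrib_left power_add mult.assoc sum_negf)
  then show ?thesis using periodic_sum_bounded[OF per] by (simp add: L_def)
qed

lemma ncf_sum_bounded:
  assumes "periodic_from (ncf_digit z) n l"
  shows "\<exists>C. \<forall>N. \<bar>(\<Sum>j<N. real_of_int (ncf_digit z j) - 3) + N * (3 - ncf_period_mean z)\<bar> \<le> C"
proof -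
  define n where "n = preperiod_length (ncf_digit z)"
  define m where "m = period_length (ncf_digit z)"
  have per: "periodic_from (\<lambda>j. real_of_int (ncf_digit z j) - 3) n m"
    using periodic_from_period_length[OF assms] by (auto simp: periodic_from_def n_def m_def)
  then have "m > 0" by (simp add: periodic_from_def)
  then have "(\<Sum>j<m. real_of_int (ncf_digit z (n + j)) - 3) / m = - (3 - ncf_period_mean z)"
    by (simp add: ncf_period_mean_def period_entry_def n_def[symmetric] m_def[symmetric]
        sum.atLeast1_atMost_eq sum_subtractf diff_divide_distrib)
  then show ?thesis using periodic_sum_bounded[OF per] by (simp only: mult_minus_right diff_minus_eq_add)
qed

theorem theorem2:
  fixes z :: real and B :: int and D :: real
  assumes "quadratic_irrational z"
  defines "B \<equiv> rcf_alternating_sum z"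
    and "D \<equiv> ncf_period_mean z"
  shows "(B > 0 \<longleftrightarrow> D < 3) \<and> (B = 0 \<longleftrightarrow> D = 3) \<and> (B < 0 \<longleftrightarrow> D > 3) \<and>
    (B > 0 \<longrightarrow> filterlim (rcf_S z) at_top sequentially \<and>
               filterlim (ncf_S z) at_top sequentially) \<and>
    (B = 0 \<longrightarrow> Bseq (rcf_S z) \<and> Bseq (ncf_S z)) \<and>
    (B < 0 \<longrightarrow> filterlim (rcf_S z) at_bot sequentially \<and>
               filterlim (ncf_S z) at_bot sequentially)"
proof -
  have irr: "z \<notin> \<rat>" using assms(1) by (simp add: quadratic_irrational_def)
  obtain n l where rem: "periodic_from (rcf_rem z) n l"
    using rcf_rem_eventually_periodic[OF assms(1)] by blast
  obtain n' l' where nrem: "periodic_from (ncf_rem z) n' l'"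
    using ncf_rem_eventually_periodic[OF irr rem] by blast
  have dig: "periodic_from (rcf_digit z) n l"
    using periodic_from_comp[OF rem, of floor] unfolding rcf_digit_def .
  have ndig: "periodic_from (ncf_digit z) n' l'"
    using periodic_from_comp[OF nrem, of ceiling] unfolding ncf_digit_def .
  define L where "L = rcf_even_period z"
  have L: "L > 0" using rcf_even_period_periodic(2)[OF dig] by (simp add: periodic_from_def L_def)
  let ?a = "\<lambda>N. \<Sum>j<N. (- 1) ^ j * real_of_int (rcf_digit z j)"
  let ?c = "\<lambda>N. \<Sum>j<N. real_of_int (ncf_digit z j) - 3"
  obtain C1 where C1: "\<bar>?a N + N * (B / L)\<bar> \<le> C1" for N
    using rcf_alternating_sum_bounded[OF dig] unfolding B_def L_def by blast
  obtain C2 where C2: "\<bar>?c N + N * (3 - D)\<bar> \<le> C2" for N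
    using ncf_sum_bounded[OF ndig] unfolding D_def by blast
  obtain C3 where C3: "\<bar>rcf_S z k + ?a (Suc k)\<bar> \<le> C3" for k
    using rcf_S_bounded[OF irr] by blast
  obtain C4 where C4: "\<bar>ncf_S z k + ?c (Suc k)\<bar> \<le> C4" for k
    using ncf_S_bounded[OF irr] by blast
  have S: "\<bar>rcf_S z k - Suc k * (B / L)\<bar> \<le> C1 + C3" "\<bar>ncf_S z k - Suc k * (3 - D)\<bar> \<le> C2 + C4" for k
    using C1[of "Suc k"] C3[of k] C2[of "Suc k"] C4[of k] by linarith+
  \<comment> \<open>At block starts the two digit sums differ by exactly 1, so their linear
    approximations agree up to \<open>C1 + C2 + 1\<close>.\<close>
  have "\<bar>block_start z (Suc i) * (3 - D) - (2 * Suc i) * (B / L)\<bar> \<le> C1 + C2 + 1" for i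
  proof -
    have "real_of_int (\<Sum>j<block_start z (Suc i). ncf_digit z j - 3)
        = real_of_int ((\<Sum>j<2 * Suc i. (- 1) ^ j * rcf_digit z j) - 1)"
      unfolding ncf_at_block_start(2)[OF irr] ..
    then have "?c (block_start z (Suc i)) = ?a (2 * Suc i) - 1" by simp
    then show ?thesis using C1[of "2 * Suc i"] C2[of "block_start z (Suc i)"] by linarith
  qed
  moreover have "i \<le> block_start z (Suc i)" for i
    using strict_mono_imp_increasing[OF strict_mono_block_start[OF irr], of "Suc i"] by simp
  ultimately have sgn: "3 - D > 0 \<longleftrightarrow> B / L > 0" "3 - D < 0 \<longleftrightarrow> B / L < 0"
    using comparable_growth_sgn[of "\<lambda>i. block_start z (Suc i)" "3 - D" "\<lambda>i. 2 * Suc i" "B / L" "C1 + C2 + 1"]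
    by simp_all
  have B: "B / L > 0 \<longleftrightarrow> B > 0" "B / L < 0 \<longleftrightarrow> B < 0"
    using L by (auto simp: zero_less_divide_iff divide_less_0_iff)
  have sgnB: "B > 0 \<longleftrightarrow> D < 3" "B < 0 \<longleftrightarrow> D > 3" using sgn unfolding B by auto
  then have "B = 0 \<longleftrightarrow> D = 3" by linarith
  with sgnB show ?thesis
    using linear_growth[OF S(1)] linear_growth[OF S(2)] unfolding B by simp
qed

end
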